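(* Let $u$ be a weight on the unit disc $\mathbb{D}$ satisfying condition $B_2$, with $\mu=u\,dA$ a probability measure, and let $\nu$ be a Borel probability measure on $\mathbb{D}$. If $\nu$ is a $\mu$-Carleson measure, then the Toeplitz operator $T_\nu:A^2(u)\to A^2(u)$ is bounded.
   Context: $\mathbb{D}$ is the open unit disc in $\mathbb{C}$ and $dA$ is Lebesgue area measure on $\mathbb{D}$ normalized so that $A(\mathbb{D})=1$. A weight is an integrable function $u\in L^1(\mathbb{D},dA)$ with $u>0$ a.e. $A^2(u)$ is the Hilbert space of analytic functions $f$ on $\mathbb{D}$ with $\|f\|_{A^2(u)}^2=\int_{\mathbb{D}}|f|^2u\,dA<\infty$, with inner product $\langle f,g\rangle_{A^2(u)}=\int_{\mathbb{D}} f\overline{g}\,u\,dA$. Condition $B_2$ (Bekollé–Bonami): there is a constant $C>0$ such that for every interval (arc) $I\subset\partial\mathbb{D}$, $$\frac{1}{A(S(I))^2}\int_{S(I)}u\,dA\int_{S(I)}\frac1u\,dA\le C,$$ where $S(I)=\{\rho e^{it}: e^{it}\in I,\ 1-\frac{|I|}{2\pi}\le \rho<1\}$ and $|I|$ is the arc length of $I$. If $u$ satisfies $B_2$, point evaluations are bounded on $A^2(u)$, and $K_u(\cdot,a)\in A^2(u)$ denotes the reproducing kernel at $a\in\mathbb{D}$: $f(a)=\langle f,K_u(\cdot,a)\rangle_{A^2(u)}$ for all $f\in A^2(u)$. $\nu$ is a $\mu$-Carleson measure if there is a constant $C>0$ such that $\int_{\mathbb{D}}|f|^2\,d\nu\le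 C\int_{\mathbb{D}}|f|^2\,d\mu$ for every polynomial $f$. The Toeplitz operator $T_\nu$ is defined on polynomials $p$ by $T_\nu p(z)=\int_{\mathbb{D}}K_u(z,w)p(w)\,d\nu(w)$. Saying that $T_\nu:A^2(u)\to A^2(u)$ is bounded means that it extends to a bounded linear operator on $A^2(u)$ given by the same formula: for every $f\in A^2(u)$ and $z\in\mathbb{D}$ the integral $T_\nu f(z)=\int_{\mathbb{D}}K_u(z,w)f(w)\,d\nu(w)$ converges absolutely, $T_\nu f\in A^2(u)$, and $\|T_\nu f\|_{A^2(u)}\le C\|f\|_{A^2(u)}$ with $C$ independent of $f$. *)

theory Defs
  imports "HOL-Analysis.Analysis" "HOL-Complex_Analysis.Complex_Analysis"
    "HOL-Probability.Probability" "HOL-Computational_Algebra.Polynomial"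
begin

abbreviation unit_disc :: "complex set" where
  "unit_disc \<equiv> ball 0 1"

definition area :: "complex measure" where
  "area = scale_measure (ennreal (1 / pi)) (lebesgue_on unit_disc)"

definition disc_weight :: "(complex \<Rightarrow> real) \<Rightarrow> bool" where
  "disc_weight u \<longleftrightarrow> integrable area u \<and> (AE z in area. u z > 0)"

definition weighted_area :: "(complex \<Rightarrow> real) \<Rightarrow> complex measure" where
  "weighted_area u = density area (\<lambda>z. ennreal (u z))"

text \<open>\<open>circle_arc I l\<close>: the set \<open>I\<close> is a nondegenerate arc of the unit circle of arc length \<open>l\<close>.
  Either endpoint may or may not belong to \<open>I\<close>, and the full circle (\<open>l = 2 * pi\<close>) is allowed.\<close>

definition circle_arc :: "complex set \<Rightarrow> real \<Rightarrow> bool" where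
  "circle_arc I l \<longleftrightarrow> 0 < l \<and> l \<le> 2 * pi \<and>
     (\<exists>a J. {a<..<a + l} \<subseteq> J \<and> J \<subseteq> {a..a + l} \<and> I = cis ` J)"

definition carleson_box :: "complex set \<Rightarrow> real \<Rightarrow> complex set" where
  "carleson_box I l =
     {of_real \<rho> * cis t | \<rho> t. cis t \<in> I \<and> 1 - l / (2 * pi) \<le> \<rho> \<and> \<rho> < 1}"

text \<open>The integrals are taken in \<^typ>\<open>ennreal\<close>, so the condition includes that \<open>1 / u\<close> is
  integrable over every box.\<close>

definition B2_condition :: "(complex \<Rightarrow> real) \<Rightarrow> bool" where
  "B2_condition u \<longleftrightarrow> (\<exists>C::real. C > 0 \<and> (\<forall>I l. circle_arc I l \<longrightarrow>
     1 / (emeasure area (carleson_box I l))\<^sup>2 *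
       (\<integral>\<^sup>+ z\<in>carleson_box I l. ennreal (u z) \<partial>area) *
       (\<integral>\<^sup>+ z\<in>carleson_box I l. ennreal (1 / u z) \<partial>area) \<le> ennreal C))"

text \<open>Elements of \<open>A\<^sup>2(u)\<close> are represented by total functions on the complex plane; their values
  outside the disc do not affect membership, norm or inner product.\<close>

definition A2 :: "(complex \<Rightarrow> real) \<Rightarrow> (complex \<Rightarrow> complex) set" where
  "A2 u = {f. f holomorphic_on unit_disc \<and> integrable area (\<lambda>z. (cmod (f z))\<^sup>2 * u z)}"

definition A2_norm :: "(complex \<Rightarrow> real) \<Rightarrow> (complex \<Rightarrow> complex) \<Rightarrow> real" where
  "A2_norm u f = sqrt (LINT z|area. (cmod (f z))\<^sup>2 * u z)"

definition A2_inner ::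
    "(complex \<Rightarrow> real) \<Rightarrow> (complex \<Rightarrow> complex) \<Rightarrow> (complex \<Rightarrow> complex) \<Rightarrow> complex" where
  "A2_inner u f g = (LINT z|area. f z * cnj (g z) * of_real (u z))"

definition reproduces_at ::
    "(complex \<Rightarrow> real) \<Rightarrow> complex \<Rightarrow> (complex \<Rightarrow> complex) \<Rightarrow> bool" where
  "reproduces_at u a k \<longleftrightarrow> k \<in> A2 u \<and> (\<forall>f\<in>A2 u. f a = A2_inner u f k)"

text \<open>When point evaluation at \<open>a \<in> unit_disc\<close> is bounded on \<open>A\<^sup>2(u)\<close>, as it is under the
  condition \<open>B\<^sub>2\<close>, the function chosen here exists and is unique on the disc.\<close>

definition bergman_kernel :: "(complex \<Rightarrow> real) \<Rightarrow> complex \<Rightarrow> complex \<Rightarrow> complex" where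
  "bergman_kernel u z a = (SOME k. reproduces_at u a k) z"

definition carleson_measure :: "complex measure \<Rightarrow> complex measure \<Rightarrow> bool" where
  "carleson_measure \<nu> \<mu> \<longleftrightarrow> (\<exists>C::real. C > 0 \<and> (\<forall>p::complex poly.
     (\<integral>\<^sup>+ z. ennreal ((cmod (poly p z))\<^sup>2) \<partial>\<nu>)
       \<le> ennreal C * (\<integral>\<^sup>+ z. ennreal ((cmod (poly p z))\<^sup>2) \<partial>\<mu>)))"

definition toeplitz ::
    "(complex \<Rightarrow> real) \<Rightarrow> complex measure \<Rightarrow> (complex \<Rightarrow> complex) \<Rightarrow> complex \<Rightarrow> complex" where
  "toeplitz u \<nu> f z = (LINT w|\<nu>. bergman_kernel u z w * f w)"

text \<open>Linearity on the disc is automatic from the absolute convergence of the defining integrals.\<close>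

definition toeplitz_bounded :: "(complex \<Rightarrow> real) \<Rightarrow> complex measure \<Rightarrow> bool" where
  "toeplitz_bounded u \<nu> \<longleftrightarrow> (\<exists>C::real. \<forall>f\<in>A2 u.
     (\<forall>z\<in>unit_disc. integrable \<nu> (\<lambda>w. bergman_kernel u z w * f w)) \<and>
     toeplitz u \<nu> f \<in> A2 u \<and>
     A2_norm u (toeplitz u \<nu> f) \<le> C * A2_norm u f)"

end

theory Submission imports Defs begin

text \<open>Applied to the whole disc, \<open>B\<^sub>2\<close> makes \<open>1 / u\<close> integrable; with the sub-mean value property and
  Cauchy--Schwarz, point evaluations are then bounded on \<open>A\<^sup>2(u)\<close>, so \<open>A\<^sup>2(u)\<close> is complete and the
  Riesz representation theorem produces the kernel.  Applied to boxes of size comparable to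
  \<open>1 - \<bar>w\<bar>\<close>, \<open>B\<^sub>2\<close> makes the dilations \<open>f(r z)\<close> uniformly bounded in \<open>A\<^sup>2(u)\<close>.  These are uniform
  limits of polynomials on the disc, so by Fatou's lemma as \<open>r\<close> tends to \<open>1\<close> the Carleson inequality
  passes from polynomials to all of \<open>A\<^sup>2(u)\<close>.  Hence \<open>g \<mapsto> \<integral> g cnj(f) d\<nu>\<close> is a bounded functional
  on \<open>A\<^sup>2(u)\<close> for each \<open>f\<close>; evaluating its Riesz representative \<open>h\<close> against the kernel gives
  \<open>T\<^sub>\<nu> f = h\<close>.\<close>

section \<open>The sub-mean value property for area integrals\<close>

text \<open>The obstacle is that the Carleson hypothesis speaks of polynomials only. Fatou's lemma
  takes the place of a density argument: it asks for pointwise convergence of the dilations and one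
  uniform bound on their norms. For that bound B_2 is read as \<mu>(S) \<sigma>(S) \<le> C A(S)^2
  with d\<sigma> = dA / u. The sub-mean value property and Cauchy-Schwarz bound |f(a)|^2 r^4 by
  \<sigma>(B) times the integral of |f|^2 d\<mu> over B, where B is the disc of radius r about a and
  r^4 = A(B)^2. Integrating such bounds over the centres against \<mu> brings in a factor \<mu>(S),
  so both measures meet in the product that B_2 controls and the powers of the radius cancel. On the
  Toeplitz side the Carleson inequality is applied to both factors of the integral of g cnj(f)
  d\<nu>. This is why the operator bound is the Carleson constant for holomorphic functions
  itself.\<close>

lemma nn_integral_lborel_plus:
  fixes F :: "'a::euclidean_space \<Rightarrow> ennreal"
  assumes [measurable]: "F \<in> borel_measurable borel"
  shows "(\<integral>\<^sup>+x. F (c + x) \<partial>lborel) = (\<integral>\<^sup>+x. F x \<partial>lborel)"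
proof -
  have "(\<integral>\<^sup>+x. F x \<partial>lborel) = (\<integral>\<^sup>+x. F x \<partial>distr lborel borel ((+) c))"
    by (simp add: lborel_distr_plus)
  also have "\<dots> = (\<integral>\<^sup>+x. F (c + x) \<partial>lborel)"
    by (rule nn_integral_distr) auto
  finally show ?thesis ..
qed

text \<open>Both sides are multiplied by the area of the unit ball \<open>B\<close>.  A translation depending on
  \<open>w \<in> B\<close> followed by Fubini moves the rotation into the rotation-invariant set \<open>B\<close>.\<close>

lemma nn_integral_lborel_rotate:
  fixes F :: "complex \<Rightarrow> ennreal"
  assumes [measurable]: "F \<in> borel_measurable borel" and c: "cmod c = 1"
  shows "(\<integral>\<^sup>+x. F (c * x) \<partial>lborel) = (\<integral>\<^sup>+x. F x \<partial>lborel)"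
proof -
  let ?B = "ball 0 1 :: complex set"
  have [measurable]: "?B \<in> sets borel" by simp
  have c0: "c \<noteq> 0" using c by auto
  have B: "emeasure lborel ?B \<noteq> 0" "emeasure lborel ?B \<noteq> top"
    by (auto simp: emeasure_ball unit_ball_vol_2 simp flip: ennreal_0)
  have shift: "(\<integral>\<^sup>+x. F (c * x) \<partial>lborel) = (\<integral>\<^sup>+x. F (c * x + w) \<partial>lborel)" for w
    using nn_integral_lborel_plus[of "\<lambda>x. F (c * x)" "w / c"] c0
    by (simp add: algebra_simps)
  \<comment> \<open>Rotation invariance of the ball enters here: - c x + w is - c times x - w / c
    and |c| = 1, so for fixed w the condition on x describes a translate of
    \<open>?B\<close>.\<close>
  have mem: "indicator ?B (- c * x + w) = (indicator ?B (- (w / c) + x) :: ennreal)" for x w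
  proof -
    have "cmod (- c * x + w) = cmod (c * (- (w / c) + x))"
      using c0 by (metis (no_types, opaque_lifting) add.commute add.inverse_inverse
          add_uminus_conv_diff distrib_left minus_add_distrib mult_minus_left mult_minus_right
          nonzero_mult_div_cancel_left norm_minus_cancel times_divide_eq_right)
    also have "\<dots> = cmod (- (w / c) + x)" by (simp add: norm_mult c)
    finally show ?thesis by (auto simp: indicator_def)
  qed
  have "emeasure lborel ?B * (\<integral>\<^sup>+x. F (c * x) \<partial>lborel)
      = (\<integral>\<^sup>+w. indicator ?B w * (\<integral>\<^sup>+x. F (c * x) \<partial>lborel) \<partial>lborel)"
    by (subst nn_integral_multc) (simp_all add: borel_measurable_indicator)
  also have "\<dots> = (\<integral>\<^sup>+w. (\<integral>\<^sup>+x. indicator ?B w * F (c * x + w) \<partial>lborel) \<partial>lborel)"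
  proof (rule nn_integral_cong)
    fix w
    show "indicator ?B w * (\<integral>\<^sup>+x. F (c * x) \<partial>lborel) = (\<integral>\<^sup>+x. indicator ?B w * F (c * x + w) \<partial>lborel)"
      by (subst shift[of w], subst nn_integral_cmult) auto
  qed
  also have "\<dots> = (\<integral>\<^sup>+x. (\<integral>\<^sup>+w. indicator ?B w * F (c * x + w) \<partial>lborel) \<partial>lborel)"
    by (rule lborel_pair.Fubini') measurable
  also have "\<dots> = (\<integral>\<^sup>+x. (\<integral>\<^sup>+w. indicator ?B (- c * x + w) * F w \<partial>lborel) \<partial>lborel)"
  proof (rule nn_integral_cong)
    fix x
    show "(\<integral>\<^sup>+w. indicator ?B w * F (c * x + w) \<partial>lborel)
        = (\<integral>\<^sup>+w. indicator ?B (- c * x + w) * F w \<partial>lborel)"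
      using nn_integral_lborel_plus[of "\<lambda>w. indicator ?B w * F (c * x + w)" "- c * x"] by simp
  qed
  also have "\<dots> = (\<integral>\<^sup>+w. (\<integral>\<^sup>+x. indicator ?B (- c * x + w) * F w \<partial>lborel) \<partial>lborel)"
    by (rule lborel_pair.Fubini') measurable
  also have "\<dots> = (\<integral>\<^sup>+w. emeasure lborel ?B * F w \<partial>lborel)"
  proof (rule nn_integral_cong)
    fix w
    have "(\<integral>\<^sup>+x. indicator ?B (- c * x + w) * F w \<partial>lborel)
        = (\<integral>\<^sup>+x. indicator ?B (- (w / c) + x) \<partial>lborel) * F w"
      by (simp only: mem, rule nn_integral_multc) auto
    also have "\<dots> = emeasure lborel ?B * F w"
      by (subst nn_integral_lborel_plus) auto
    finally show "(\<integral>\<^sup>+x. indicator ?B (- c * x + w) * F w \<partial>lborel) = emeasure lborel ?B * F w" .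
  qed
  also have "\<dots> = emeasure lborel ?B * (\<integral>\<^sup>+w. F w \<partial>lborel)"
    by (rule nn_integral_cmult) auto
  finally show ?thesis using B by (simp add: ennreal_mult_cancel_left)
qed

text \<open>Cauchy's formula at the centre: on the unit circle dw / w = 2 pi i dt, so the contour
  integral is 2 pi i times a plain average over t in [0, 1].\<close>

lemma norm_le_circle_average:
  assumes g: "g holomorphic_on ball 0 R" and R: "R > 1"
  shows "ennreal (cmod (g 0)) \<le>
    (\<integral>\<^sup>+t. ennreal (cmod (g (exp (2 * of_real pi * \<i> * of_real t)))) * indicator {0..1::real} t \<partial>lborel)"
proof -
  let ?e = "\<lambda>t::real. exp (2 * of_real pi * \<i> * of_real t) :: complex"
  have sub: "cball 0 1 \<subseteq> ball (0::complex) R" using R by auto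
  have "((\<lambda>w. g w / (w - 0)) has_contour_integral (2 * of_real pi * \<i> * g 0)) (circlepath 0 1)"
    using R by (intro Cauchy_integral_circlepath continuous_on_subset[OF holomorphic_on_imp_continuous_on[OF g] sub]
        holomorphic_on_subset[OF g]) auto
  then have "((\<lambda>t. g (?e t) / ?e t * (2 * of_real pi * \<i> * ?e t)) has_integral 2 * of_real pi * \<i> * g 0) {0..1}"
    by (simp add: has_contour_integral vector_derivative_circlepath) (simp add: circlepath)
  then have "((\<lambda>t. (2 * of_real pi * \<i>) * g (?e t)) has_integral (2 * of_real pi * \<i>) * g 0) {0..1}"
    by (simp add: field_simps)
  then have "((\<lambda>t. inverse (2 * of_real pi * \<i>) * ((2 * of_real pi * \<i>) * g (?e t)))
      has_integral inverse (2 * of_real pi * \<i>) * ((2 * of_real pi * \<i>) * g 0)) {0..1}"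
    by (rule has_integral_mult_right)
  then have I: "((\<lambda>t. g (?e t)) has_integral g 0) {0..1}"
    by (simp add: field_simps)
  have cont: "continuous_on {0..1} (\<lambda>t. g (?e t))"
    by (intro continuous_on_compose2[OF holomorphic_on_imp_continuous_on[OF g]] continuous_intros)
      (use R in auto)
  then have n: "(\<lambda>t. cmod (g (?e t))) integrable_on {0..1}"
    by (intro integrable_continuous_interval continuous_intros)
  have "cmod (g 0) \<le> integral {0..1} (\<lambda>t. cmod (g (?e t)))"
    using integral_norm_bound_integral[of "\<lambda>t. g (?e t)" "{0..1}" "\<lambda>t. cmod (g (?e t))"] I n
    by (simp add: integral_unique has_integral_integrable)
  then have "ennreal (cmod (g 0)) \<le> ennreal (integral {0..1} (\<lambda>t. cmod (g (?e t))))"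
    by (rule ennreal_leI)
  also have "\<dots> = (\<integral>\<^sup>+t. ennreal (cmod (g (?e t))) * indicator {0..1} t \<partial>lborel)"
    using n by (subst nn_integral_has_integral_lebesgue') (auto simp: has_integral_integral)
  finally show ?thesis .
qed

text \<open>Rotations take the place of polar coordinates. For v in the centred ball, the average of
  |f| over the circle about a through a + v is at least |f(a)|. After integration over v and Fubini,
  rotation invariance makes the integral over v the same for every t, so the average over t
  disappears.\<close>

lemma holomorphic_submean_disc:
  assumes f: "f holomorphic_on ball a r"
  shows "ennreal (cmod (f a)) * emeasure lborel (ball a r)
    \<le> (\<integral>\<^sup>+z. ennreal (cmod (f z)) * indicator (ball a r) z \<partial>lborel)"
proof -
  let ?e = "\<lambda>t::real. exp (2 * of_real pi * \<i> * of_real t) :: complex"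
  define F where "F z = ennreal (cmod (f z)) * indicator (ball a r) z" for z
  have "(\<lambda>z. indicator (ball a r) z *\<^sub>R f z) \<in> borel_measurable borel"
    using f by (intro borel_measurable_continuous_on_indicator holomorphic_on_imp_continuous_on) auto
  then have "(\<lambda>z. ennreal (cmod (indicator (ball a r) z *\<^sub>R f z))) \<in> borel_measurable borel"
    by measurable
  also have "(\<lambda>z. ennreal (cmod (indicator (ball a r) z *\<^sub>R f z))) = F"
    by (auto simp: F_def indicator_def)
  finally have [measurable]: "F \<in> borel_measurable borel" .
  have pt: "ennreal (cmod (f a)) * indicator (ball 0 r) v
      \<le> (\<integral>\<^sup>+t. F (a + ?e t * v) * indicator {0..1} t \<partial>lborel)" for v
  proof (cases "v \<in> ball 0 r")
    case True
    then have v: "cmod v < r" by simp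
    \<comment> \<open>Sending w to a + w v must map a disc larger than the closed unit disc into the
      ball. For v nonzero, R is the midpoint of 1 and r / |v|.\<close>
    obtain R where R: "R > 1" "R * cmod v < r"
    proof (cases "v = 0")
      case True
      then show ?thesis using v that[of 2] by simp
    next
      case False
      then show ?thesis using v that[of "(1 + r / cmod v) / 2"]
        by (simp add: field_simps)
    qed
    have maps: "a + w * v \<in> ball a r" if "w \<in> ball 0 R" for w
    proof -
      have "cmod w * cmod v \<le> R * cmod v" using that by (intro mult_right_mono) auto
      then show ?thesis using R by (simp add: dist_norm norm_mult)
    qed
    have "(f \<circ> (\<lambda>w. a + w * v)) holomorphic_on ball 0 R"
      by (rule holomorphic_on_compose_gen[OF _ f]) (use maps in \<open>auto intro!: holomorphic_intros\<close>)
    from norm_le_circle_average[OF this R(1)]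
    have "ennreal (cmod (f a)) \<le> (\<integral>\<^sup>+t. ennreal (cmod (f (a + ?e t * v))) * indicator {0..1} t \<partial>lborel)"
      by simp
    also have "\<dots> = (\<integral>\<^sup>+t. F (a + ?e t * v) * indicator {0..1} t \<partial>lborel)"
    proof -
      have "a + ?e t * v \<in> ball a r" for t using maps[of "?e t"] R by simp
      then show ?thesis by (simp add: F_def)
    qed
    finally show ?thesis using True by simp
  qed simp
  have "emeasure lborel (ball a r) = emeasure lborel (ball (0::complex) r)"
    by (cases "r \<ge> 0") (auto simp: emeasure_ball ball_empty)
  then have "ennreal (cmod (f a)) * emeasure lborel (ball a r)
      = (\<integral>\<^sup>+v. ennreal (cmod (f a)) * indicator (ball (0::complex) r) v \<partial>lborel)"
    by (simp add: nn_integral_cmult_indicator)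
  also have "\<dots> \<le> (\<integral>\<^sup>+v. (\<integral>\<^sup>+t. F (a + ?e t * v) * indicator {0..1} t \<partial>lborel) \<partial>lborel)"
    by (rule nn_integral_mono) (rule pt)
  also have "\<dots> = (\<integral>\<^sup>+t. (\<integral>\<^sup>+v. F (a + ?e t * v) * indicator {0..1} t \<partial>lborel) \<partial>lborel)"
    by (rule lborel_pair.Fubini') measurable
  also have "\<dots> = (\<integral>\<^sup>+t. (\<integral>\<^sup>+v. F v \<partial>lborel) * indicator {0..1::real} t \<partial>lborel)"
  proof (rule nn_integral_cong)
    fix t :: real
    have "(\<integral>\<^sup>+v. F (a + ?e t * v) \<partial>lborel) = (\<integral>\<^sup>+v. F v \<partial>lborel)"
      using nn_integral_lborel_rotate[of "\<lambda>v. F (a + v)" "?e t"] nn_integral_lborel_plus[of F a]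
      by simp
    then show "(\<integral>\<^sup>+v. F (a + ?e t * v) * indicator {0..1} t \<partial>lborel)
        = (\<integral>\<^sup>+v. F v \<partial>lborel) * indicator {0..1} t"
      by (simp add: nn_integral_multc)
  qed
  also have "\<dots> = (\<integral>\<^sup>+v. F v \<partial>lborel)"
    by (simp add: nn_integral_cmult)
  finally show ?thesis by (simp add: F_def)
qed

section \<open>Carleson boxes and the \<open>B\<^sub>2\<close> condition\<close>

lemma space_area [simp]: "space area = unit_disc"
  by (simp add: area_def space_scale_measure)

lemma sets_area: "sets area = sets (lebesgue_on unit_disc)"
  by (simp add: area_def)

lemma borel_measurable_area_continuous:
  fixes f :: "complex \<Rightarrow> 'b::euclidean_space"
  assumes "continuous_on unit_disc f"
  shows "f \<in> borel_measurable area"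
  using continuous_imp_measurable_on_sets_lebesgue[OF assms]
  by (simp add: sets_area cong: measurable_cong_sets)

lemma borel_Int_disc_in_sets_area: "A \<in> sets borel \<Longrightarrow> A \<inter> unit_disc \<in> sets area"
  by (auto simp: sets_area sets_restrict_space)

lemma nn_integral_area:
  assumes "f \<in> borel_measurable area"
  shows "(\<integral>\<^sup>+z. f z \<partial>area) = ennreal (1 / pi) * (\<integral>\<^sup>+z. f z * indicator unit_disc z \<partial>lborel)"
proof -
  have "f \<in> borel_measurable (lebesgue_on unit_disc)"
    using assms by (simp add: sets_area cong: measurable_cong_sets)
  then show ?thesis
    unfolding area_def
    by (simp add: nn_integral_scale_measure nn_integral_restrict_space nn_integral_completion)
qed

text \<open>The case split covers a non-measurable S, whose \<open>emeasure\<close> is 0, so the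
  bound applies directly to Carleson boxes.\<close>

lemma emeasure_area_le_ball: "r \<ge> 0 \<Longrightarrow> S \<subseteq> ball c r \<Longrightarrow> emeasure area S \<le> ennreal (r\<^sup>2)"
proof (cases "S \<in> sets area")
  case True
  assume r: "r \<ge> 0" and S: "S \<subseteq> ball c r"
  have "emeasure area S \<le> emeasure area (ball c r \<inter> unit_disc)"
    using S sets.sets_into_space[OF True] by (intro emeasure_mono borel_Int_disc_in_sets_area) auto
  also have "\<dots> = ennreal (1 / pi) * emeasure lborel (ball c r \<inter> unit_disc)"
    by (simp add: area_def emeasure_restrict_space)
  also have "\<dots> \<le> ennreal (1 / pi) * emeasure lborel (ball c r)"
    by (intro mult_left_mono emeasure_mono) auto
  also have "\<dots> = ennreal (r\<^sup>2)"
    using r by (simp add: emeasure_ball unit_ball_vol_2 flip: ennreal_mult)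
  finally show ?thesis .
qed (simp add: emeasure_notin_sets)

lemma holomorphic_submean_area:
  assumes f: "f holomorphic_on unit_disc" and sub: "ball a r \<subseteq> unit_disc" and r: "r \<ge> 0"
  shows "ennreal (cmod (f a)) * ennreal (r\<^sup>2)
    \<le> (\<integral>\<^sup>+z. ennreal (cmod (f z)) * indicator (ball a r) z \<partial>area)"
proof -
  have [measurable]: "f \<in> borel_measurable area"
    using f by (intro borel_measurable_area_continuous holomorphic_on_imp_continuous_on)
  have [measurable]: "Measurable.pred area (\<lambda>z. z \<in> ball a r)"
    using borel_Int_disc_in_sets_area[of "ball a r"]
    by (simp add: pred_def Int_def conj_commute del: mem_ball)
  have "ennreal (cmod (f a)) * ennreal (r\<^sup>2)
      = ennreal (1 / pi) * (ennreal (cmod (f a)) * emeasure lborel (ball a r))"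
    using r by (simp add: emeasure_ball unit_ball_vol_2 flip: ennreal_mult)
  also have "\<dots> \<le> ennreal (1 / pi) * (\<integral>\<^sup>+z. ennreal (cmod (f z)) * indicator (ball a r) z \<partial>lborel)"
    by (intro mult_left_mono holomorphic_submean_disc holomorphic_on_subset[OF f sub]) auto
  also have "(\<integral>\<^sup>+z. ennreal (cmod (f z)) * indicator (ball a r) z \<partial>lborel)
      = (\<integral>\<^sup>+z. ennreal (cmod (f z)) * indicator (ball a r) z * indicator unit_disc z \<partial>lborel)"
    using sub by (intro nn_integral_cong) (auto simp: indicator_def)
  also have "ennreal (1 / pi) * \<dots> = (\<integral>\<^sup>+z. ennreal (cmod (f z)) * indicator (ball a r) z \<partial>area)"
    by (rule nn_integral_area[symmetric]) measurable
  finally show ?thesis .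
qed

text \<open>Rotate w onto the positive axis: then \<zeta> is within 3 h + h = 4 h < 1/2 of the point
  1, and the logarithm bound puts its angle within 8 h. The box has half-angle 16 h and depth 32 h /
  (2 pi), which is at least 4 h because pi < 4.\<close>

lemma ball_subset_carleson_box:
  assumes w: "cmod w < 1" and h: "h = 1 - cmod w" "h < 1 / 8"
    and z: "cmod z < 1" "cmod (z - w) < 3 * h"
  shows "z \<in> carleson_box (cis ` {Arg w - 16 * h..Arg w - 16 * h + 32 * h}) (32 * h)"
proof -
  define \<zeta> where "\<zeta> = z * cis (- Arg w)"
  have "w = of_real (cmod w) * cis (Arg w)" by (metis rcis_cmod_Arg rcis_def)
  then have w_rot: "w * cis (- Arg w) = of_real (cmod w)"
    by (metis (no_types, lifting) cis_mult mult.assoc add.right_inverse cis_zero mult.right_neutral)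
  have "cmod (\<zeta> - of_real (cmod w)) = cmod ((z - w) * cis (- Arg w))"
    using w_rot by (simp add: \<zeta>_def algebra_simps)
  also have "\<dots> < 3 * h" using z by (simp add: norm_mult)
  finally have "cmod (\<zeta> - of_real (cmod w)) < 3 * h" .
  moreover have "cmod (of_real (cmod w) - 1 :: complex) = h"
    using w unfolding h(1) by (metis abs_minus_commute abs_of_pos diff_gt_0_iff_gt norm_of_real of_real_1 of_real_diff)
  moreover have "cmod (\<zeta> - 1) \<le> cmod (\<zeta> - of_real (cmod w)) + cmod (of_real (cmod w) - 1)"
    using norm_triangle_ineq[of "\<zeta> - of_real (cmod w)" "of_real (cmod w) - 1"] by simp
  ultimately have \<zeta>1: "cmod (\<zeta> - 1) < 4 * h" by linarith
  have \<zeta>0: "\<zeta> \<noteq> 0" using \<zeta>1 h by auto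
  define t where "t = Im (Ln \<zeta>)"
  have "cmod (Ln (1 + (\<zeta> - 1))) \<le> 2 * cmod (\<zeta> - 1)"
    using \<zeta>1 h by (intro norm_Ln_le) auto
  then have t: "\<bar>t\<bar> \<le> 8 * h"
    using \<zeta>1 abs_Im_le_cmod[of "Ln \<zeta>"] by (simp add: t_def)
  have "\<zeta> = exp (Ln \<zeta>)" using \<zeta>0 by simp
  also have "\<dots> = of_real (cmod \<zeta>) * cis t"
    using \<zeta>0 by (subst exp_eq_polar) (simp add: t_def)
  finally have \<zeta>_polar: "\<zeta> = of_real (cmod \<zeta>) * cis t" .
  have "z = \<zeta> * cis (Arg w)" by (simp add: \<zeta>_def cis_mult mult.assoc)
  then have z_polar: "z = of_real (cmod \<zeta>) * cis (Arg w + t)"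
    by (subst (asm) \<zeta>_polar) (simp add: cis_mult mult.assoc add.commute)
  have "1 - cmod \<zeta> \<le> cmod (\<zeta> - 1)"
    by (metis norm_minus_commute norm_one norm_triangle_ineq2)
  also have "\<dots> \<le> 4 * h" using \<zeta>1 by simp
  also have "\<dots> \<le> 32 * h / (2 * pi)"
    using h w pi_less_4 by (simp add: field_simps)
  finally have "1 - 32 * h / (2 * pi) \<le> cmod \<zeta>" by simp
  moreover have "cmod \<zeta> < 1" using z by (simp add: \<zeta>_def norm_mult)
  moreover have "cis (Arg w + t) \<in> cis ` {Arg w - 16 * h..Arg w - 16 * h + 32 * h}"
    using t by (intro imageI) auto
  ultimately show ?thesis unfolding carleson_box_def using z_polar by blast
qed

text \<open>Radially a point of the box is within 16 h / pi < 16 h of the circle, and along the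
  circle within 16 h of the centre of the arc, since a chord is no longer than its arc. This bounds
  the area of the box by a multiple of h^2.\<close>

lemma carleson_box_subset_ball:
  assumes h: "h > 0" "h < 1 / 8"
  shows "carleson_box (cis ` {\<theta> - 16 * h..\<theta> - 16 * h + 32 * h}) (32 * h) \<subseteq> ball (cis \<theta>) (32 * h)"
proof
  fix z assume "z \<in> carleson_box (cis ` {\<theta> - 16 * h..\<theta> - 16 * h + 32 * h}) (32 * h)"
  then obtain \<rho> s where zs: "z = of_real \<rho> * cis s" "1 - 32 * h / (2 * pi) \<le> \<rho>" "\<rho> < 1"
    "s \<in> {\<theta> - 16 * h..\<theta> - 16 * h + 32 * h}"
    unfolding carleson_box_def by force
  have "cmod (z - cis s) = \<bar>\<rho> - 1\<bar>"
  proof -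
    have "z - cis s = of_real (\<rho> - 1) * cis s" using zs by (simp add: algebra_simps)
    then show ?thesis by (simp only: norm_mult norm_of_real norm_cis mult_1_right)
  qed
  also have "\<dots> \<le> 32 * h / (2 * pi)" using zs by simp
  also have "\<dots> < 16 * h" using h pi_gt3 by (simp add: field_simps)
  finally have 1: "cmod (z - cis s) < 16 * h" .
  have "cis s - cis \<theta> = cis \<theta> * (cis (s - \<theta>) - 1)"
    by (simp add: algebra_simps cis_mult)
  then have "cmod (cis s - cis \<theta>) = cmod (cis (s - \<theta>) - 1)"
    by (simp add: norm_mult)
  also have "\<dots> = 2 * \<bar>sin ((s - \<theta>) / 2)\<bar>"
    using dist_exp_i_1[of "s - \<theta>"] by (simp add: cis_conv_exp)
  also have "\<dots> \<le> \<bar>s - \<theta>\<bar>" using abs_sin_x_le_abs_x[of "(s - \<theta>) / 2"] by simp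
  also have "\<dots> \<le> 16 * h" using zs by auto
  finally have 2: "cmod (cis s - cis \<theta>) \<le> 16 * h" .
  have "cmod (z - cis \<theta>) \<le> cmod (z - cis s) + cmod (cis s - cis \<theta>)"
    using norm_triangle_ineq[of "z - cis s" "cis s - cis \<theta>"] by simp
  then show "z \<in> ball (cis \<theta>) (32 * h)" using 1 2 by (simp add: dist_norm norm_minus_commute)
qed

text \<open>For l = 2 pi the radial condition is 0 \<le> \<rho>, so the box of the full circle
  reaches the origin.\<close>

lemma disc_subset_full_carleson_box:
  "z \<in> unit_disc \<Longrightarrow> z \<in> carleson_box (cis ` {- pi..- pi + 2 * pi}) (2 * pi)"
  unfolding carleson_box_def
  using Arg_bounded[of z] rcis_cmod_Arg[of z]
  by (intro CollectI exI[of _ "cmod z"] exI[of _ "Arg z"]) (auto simp: rcis_def)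

text \<open>Clearing the denominator reduces each application of B_2 to an inclusion in a box and an
  upper bound for the area of that box.\<close>

lemma B2_condition_boxD:
  assumes "B2_condition u"
  obtains C :: real where "C > 0"
    "\<And>a l r T. \<lbrakk>0 < l; l \<le> 2 * pi; r \<ge> 0; emeasure area (carleson_box (cis ` {a..a + l}) l) \<le> ennreal r;
       T \<subseteq> carleson_box (cis ` {a..a + l}) l\<rbrakk> \<Longrightarrow>
       (\<integral>\<^sup>+z\<in>T. ennreal (u z) \<partial>area) * (\<integral>\<^sup>+z\<in>T. ennreal (1 / u z) \<partial>area) \<le> ennreal (C * r\<^sup>2)"
proof -
  obtain C :: real where C: "C > 0" and B: "\<And>I l. circle_arc I l \<Longrightarrow>
     1 / (emeasure area (carleson_box I l))\<^sup>2 *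
       (\<integral>\<^sup>+ z\<in>carleson_box I l. ennreal (u z) \<partial>area) *
       (\<integral>\<^sup>+ z\<in>carleson_box I l. ennreal (1 / u z) \<partial>area) \<le> ennreal C"
    using assms unfolding B2_condition_def by blast
  show ?thesis
  proof (rule that[OF C])
    fix a l r :: real and T :: "complex set"
    assume l: "0 < l" "l \<le> 2 * pi" and r: "r \<ge> 0"
    let ?S = "carleson_box (cis ` {a..a + l}) l"
    assume A: "emeasure area ?S \<le> ennreal r" and T: "T \<subseteq> ?S"
    let ?U = "\<integral>\<^sup>+ z\<in>?S. ennreal (u z) \<partial>area" and ?V = "\<integral>\<^sup>+ z\<in>?S. ennreal (1 / u z) \<partial>area"
    let ?X = "(emeasure area ?S)\<^sup>2"
    have "circle_arc (cis ` {a..a + l}) l"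
      unfolding circle_arc_def using l by (intro conjI exI[of _ a] exI[of _ "{a..a + l}"]) auto
    from B[OF this] have B': "1 / ?X * (?U * ?V) \<le> ennreal C" by (simp add: mult.assoc)
    have X: "?X \<le> ennreal (r\<^sup>2)"
      using power_mono[OF A, of 2] r by (simp add: ennreal_power)
    have Xtop: "?X < top" using X by (rule order.strict_trans1) simp
    have "?U * ?V \<le> ennreal C * ?X"
    \<comment> \<open>In \<open>ennreal\<close>, 1 / 0 is \<open>top\<close>, so for a box of
      measure 0 the finite bound forces the product of the integrals to vanish.\<close>
    proof (cases "?X = 0")
      case True
      then have "top * (?U * ?V) \<le> ennreal C" using B' by simp
      then have "?U * ?V = 0"
        by (auto simp: ennreal_top_mult top_unique split: if_splits)
      then show ?thesis by (metis zero_le)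
    next
      case False
      have "?U * ?V = (1 / ?X * (?U * ?V)) * ?X"
      proof -
        have "1 / ?X * ?X = 1" using False Xtop by (simp add: ennreal_divide_times)
        moreover have "(1 / ?X * (?U * ?V)) * ?X = (1 / ?X * ?X) * (?U * ?V)" by (simp only: mult_ac)
        ultimately show ?thesis by simp
      qed
      also have "\<dots> \<le> ennreal C * ?X" by (intro mult_right_mono B') auto
      finally show ?thesis .
    qed
    also have "\<dots> \<le> ennreal C * ennreal (r\<^sup>2)" by (intro mult_left_mono X) auto
    also have "\<dots> = ennreal (C * r\<^sup>2)" using C by (simp add: ennreal_mult)
    finally have *: "?U * ?V \<le> ennreal (C * r\<^sup>2)" .
    have "(\<integral>\<^sup>+z\<in>T. ennreal (u z) \<partial>area) * (\<integral>\<^sup>+z\<in>T. ennreal (1 / u z) \<partial>area) \<le> ?U * ?V"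
      using T by (intro mult_mono nn_integral_mono) (auto simp: indicator_def)
    with * show "(\<integral>\<^sup>+z\<in>T. ennreal (u z) \<partial>area) * (\<integral>\<^sup>+z\<in>T. ennreal (1 / u z) \<partial>area) \<le> ennreal (C * r\<^sup>2)"
      by (rule order_trans[rotated])
  qed
qed

text \<open>The power 4 is the square of an area of order h^2, with h = 1 - |w|. Points near the
  circle get a box of arc length 32 h; for the others h is bounded below and the full box
  suffices.\<close>

lemma B2_condition_ballD:
  assumes "B2_condition u"
  obtains C :: real where "C > 0"
    "\<And>w. w \<in> unit_disc \<Longrightarrow>
       (\<integral>\<^sup>+z\<in>unit_disc \<inter> ball w (3 * (1 - cmod w)). ennreal (u z) \<partial>area) *
       (\<integral>\<^sup>+z\<in>unit_disc \<inter> ball w (3 * (1 - cmod w)). ennreal (1 / u z) \<partial>area)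
       \<le> ennreal (C * (1 - cmod w) ^ 4)"
    "(\<integral>\<^sup>+z\<in>unit_disc. ennreal (u z) \<partial>area) * (\<integral>\<^sup>+z\<in>unit_disc. ennreal (1 / u z) \<partial>area) \<le> ennreal C"
proof -
  obtain C :: real where C: "C > 0" and box:
    "\<And>a l r T. \<lbrakk>0 < l; l \<le> 2 * pi; r \<ge> 0; emeasure area (carleson_box (cis ` {a..a + l}) l) \<le> ennreal r;
       T \<subseteq> carleson_box (cis ` {a..a + l}) l\<rbrakk> \<Longrightarrow>
       (\<integral>\<^sup>+z\<in>T. ennreal (u z) \<partial>area) * (\<integral>\<^sup>+z\<in>T. ennreal (1 / u z) \<partial>area) \<le> ennreal (C * r\<^sup>2)"
    using B2_condition_boxD[OF assms] by blast
  have full: "(\<integral>\<^sup>+z\<in>T. ennreal (u z) \<partial>area) * (\<integral>\<^sup>+z\<in>T. ennreal (1 / u z) \<partial>area) \<le> ennreal (C * 1\<^sup>2)"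
    if "T \<subseteq> unit_disc" for T
  proof (rule box)
    show "0 < 2 * pi" "2 * pi \<le> 2 * pi" "0 \<le> (1::real)" by auto
    have "carleson_box (cis ` {- pi..- pi + 2 * pi}) (2 * pi) \<subseteq> ball 0 1"
      by (auto simp: carleson_box_def norm_mult)
    then show "emeasure area (carleson_box (cis ` {- pi..- pi + 2 * pi}) (2 * pi)) \<le> ennreal 1"
      using emeasure_area_le_ball[of 1 _ 0] by simp
    show "T \<subseteq> carleson_box (cis ` {- pi..- pi + 2 * pi}) (2 * pi)"
      using that disc_subset_full_carleson_box by blast
  qed
  \<comment> \<open>One constant serves both cases: a small box has area at most (32 h)^2, and for h
    \<ge> 1/8 the factor (32 h)^4 exceeds 1.\<close>
  define K where "K = 32 ^ 4 * C"
  have K: "K > 0" "C \<le> K" using C by (auto simp: K_def)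
  show ?thesis
  proof (rule that[OF K(1)])
    fix w :: complex assume w: "w \<in> unit_disc"
    define h where "h = 1 - cmod w"
    have h0: "h > 0" using w by (simp add: h_def)
    let ?T = "unit_disc \<inter> ball w (3 * h)"
    let ?I = "(\<integral>\<^sup>+z\<in>?T. ennreal (u z) \<partial>area) * (\<integral>\<^sup>+z\<in>?T. ennreal (1 / u z) \<partial>area)"
    have "?I \<le> ennreal (K * h ^ 4)"
    proof (cases "h < 1 / 8")
      case True
      have "?I \<le> ennreal (C * ((32 * h)\<^sup>2)\<^sup>2)"
      proof (rule box)
        show "0 < 32 * h" "32 * h \<le> 2 * pi" "0 \<le> (32 * h)\<^sup>2"
          using h0 True pi_gt3 by auto
        show "emeasure area (carleson_box (cis ` {Arg w - 16 * h..Arg w - 16 * h + 32 * h}) (32 * h)) \<le> ennreal ((32 * h)\<^sup>2)"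
          using carleson_box_subset_ball[OF h0 True] h0 by (intro emeasure_area_le_ball) auto
        show "?T \<subseteq> carleson_box (cis ` {Arg w - 16 * h..Arg w - 16 * h + 32 * h}) (32 * h)"
          using w True by (intro subsetI ball_subset_carleson_box)
            (auto simp: h_def dist_norm norm_minus_commute)
      qed
      also have "C * ((32 * h)\<^sup>2)\<^sup>2 = K * h ^ 4" by (simp add: K_def power_mult_distrib)
      finally show ?thesis .
    next
      case False
      have "?I \<le> ennreal (C * 1\<^sup>2)" by (rule full) auto
      also have "\<dots> \<le> ennreal (K * h ^ 4)"
      proof (rule ennreal_leI)
        have "1 ^ 4 \<le> (32 * h) ^ 4" using False by (intro power_mono) auto
        then have "C * 1 \<le> C * (32 * h) ^ 4" using C by (intro mult_left_mono) auto
        then show "C * 1\<^sup>2 \<le> K * h ^ 4" by (simp add: K_def power_mult_distrib)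
      qed
      finally show ?thesis .
    qed
    then show "(\<integral>\<^sup>+z\<in>unit_disc \<inter> ball w (3 * (1 - cmod w)). ennreal (u z) \<partial>area) *
       (\<integral>\<^sup>+z\<in>unit_disc \<inter> ball w (3 * (1 - cmod w)). ennreal (1 / u z) \<partial>area)
       \<le> ennreal (K * (1 - cmod w) ^ 4)" by (simp add: h_def)
  next
    show "(\<integral>\<^sup>+z\<in>unit_disc. ennreal (u z) \<partial>area) * (\<integral>\<^sup>+z\<in>unit_disc. ennreal (1 / u z) \<partial>area) \<le> ennreal K"
      using full[of unit_disc] K by (auto intro: order_trans ennreal_leI)
  qed
qed

section \<open>Dilations and the Carleson embedding\<close>

lemma holomorphic_measurable_area:
  "f holomorphic_on unit_disc \<Longrightarrow> f \<in> borel_measurable area"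
  by (intro borel_measurable_area_continuous holomorphic_on_imp_continuous_on)

lemma holomorphic_dilation:
  assumes f: "f holomorphic_on unit_disc" and r: "0 < r" "r < 1"
  shows "(\<lambda>z. f (of_real r * z)) holomorphic_on unit_disc"
proof -
  have "(f \<circ> (\<lambda>z. of_real r * z)) holomorphic_on unit_disc"
  proof (rule holomorphic_on_compose_gen[OF _ f])
    show "(*) (complex_of_real r) ` unit_disc \<subseteq> unit_disc"
    proof clarify
      fix z :: complex assume z: "z \<in> unit_disc"
      have "r * cmod z \<le> 1 * cmod z" using r by (intro mult_right_mono) auto
      then show "of_real r * z \<in> unit_disc" using z r by (simp add: norm_mult)
    qed
  qed (intro holomorphic_intros)
  then show ?thesis by (simp add: o_def)
qed

text \<open>The approximants are Taylor polynomials of z \<mapsto> f(r z). The Taylor series of f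
  converges absolutely at r, and this dominates the dilated series uniformly in the disc.\<close>

lemma dilation_polynomial_approx:
  fixes f :: "complex \<Rightarrow> complex"
  assumes f: "f holomorphic_on unit_disc" and r: "0 < r" "r < 1" and e: "\<epsilon> > 0"
  obtains p :: "complex poly" where "\<And>z. z \<in> unit_disc \<Longrightarrow> cmod (poly p z - f (of_real r * z)) \<le> \<epsilon>"
proof -
  define a where "a n = (deriv ^^ n) f 0 / fact n" for n
  have s: "(\<lambda>n. a n * w ^ n) sums f w" if "w \<in> unit_disc" for w
    using holomorphic_power_series[OF f that] by (simp add: a_def)
  define b where "b n = cmod (a n * of_real r ^ n)" for n
  \<comment> \<open>Convergence at a point of modulus strictly between r and 1 gives absolute
    convergence at r.\<close>
  have "of_real ((1 + r) / 2) \<in> unit_disc"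
    using r unfolding mem_ball_0 norm_of_real by simp
  then have "summable (\<lambda>n. a n * of_real ((1 + r) / 2) ^ n)"
    using s by (blast intro: sums_summable)
  moreover have "cmod (of_real r) < cmod (of_real ((1 + r) / 2))"
    using r by (simp only: norm_of_real) simp
  ultimately have b: "summable b" unfolding b_def by (rule powser_insidea)
  from suminf_exist_split[OF e b] obtain N where N: "norm (\<Sum>n. b (n + N)) < \<epsilon>" by auto
  define p where "p = (\<Sum>n<N. monom (a n * of_real r ^ n) n)"
  show ?thesis
  proof (rule that[of p])
    fix z :: complex assume z: "z \<in> unit_disc"
    define c where "c n = a n * (of_real r * z) ^ n" for n
    have "r * cmod z \<le> 1 * cmod z" using r by (intro mult_right_mono) auto
    then have "of_real r * z \<in> unit_disc" using z r by (simp add: norm_mult)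
    from s[OF this] have c: "c sums f (of_real r * z)" unfolding c_def .
    have cb: "cmod (c n) \<le> b n" for n
    proof -
      have "cmod z ^ n \<le> 1" using z by (intro power_le_one) auto
      then have "b n * cmod z ^ n \<le> b n * 1" by (intro mult_left_mono) (auto simp: b_def)
      then show ?thesis by (simp add: c_def b_def norm_mult norm_power power_mult_distrib mult.assoc)
    qed
    have pz: "poly p z = (\<Sum>n<N. c n)"
      by (simp add: p_def poly_sum poly_monom c_def power_mult_distrib mult.assoc)
    have "f (of_real r * z) - poly p z = (\<Sum>n. c (n + N))"
      unfolding pz using suminf_minus_initial_segment[OF sums_summable[OF c], of N] sums_unique[OF c] by simp
    moreover have "cmod (\<Sum>n. c (n + N)) \<le> (\<Sum>n. b (n + N))"
      by (rule norm_suminf_le) (auto simp: cb b)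
    ultimately have "cmod (f (of_real r * z) - poly p z) \<le> \<epsilon>"
      using N by (simp add: abs_less_iff)
    then show "cmod (poly p z - f (of_real r * z)) \<le> \<epsilon>"
      by (subst norm_minus_commute)
  qed
qed

section \<open>The weight, its dual measure and pointwise estimates\<close>

locale b2_weight =
  fixes u :: "complex \<Rightarrow> real"
  assumes weight: "disc_weight u" and B2: "B2_condition u" and prob: "prob_space (weighted_area u)"
begin

abbreviation \<mu> :: "complex measure" where "\<mu> \<equiv> weighted_area u"

text \<open>The dual measure: B_2 bounds \<mu>(S) \<sigma>(S) by a multiple of the squared area, and
  \<sigma> is the price of passing from \<open>area\<close> to \<mu> by Cauchy-Schwarz.\<close>

definition \<sigma> :: "complex measure" where "\<sigma> = density area (\<lambda>z. ennreal (1 / u z))"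

lemma u_measurable [measurable]: "u \<in> borel_measurable area"
  using weight by (auto simp: disc_weight_def)

lemma u_pos: "AE z in area. u z > 0"
  using weight by (auto simp: disc_weight_def)

lemma sets_\<mu> [measurable_cong]: "sets \<mu> = sets area"
  by (simp add: weighted_area_def)

lemma sets_\<sigma> [measurable_cong]: "sets \<sigma> = sets area"
  by (simp add: \<sigma>_def)

lemma space_\<mu> [simp]: "space \<mu> = unit_disc" and space_\<sigma> [simp]: "space \<sigma> = unit_disc"
  by (simp_all add: weighted_area_def \<sigma>_def)

lemma nn_integral_\<mu>:
  "f \<in> borel_measurable area \<Longrightarrow> (\<integral>\<^sup>+z. f z \<partial>\<mu>) = (\<integral>\<^sup>+z. ennreal (u z) * f z \<partial>area)"
  by (simp add: weighted_area_def nn_integral_density)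

lemma emeasure_\<mu>: "T \<in> sets area \<Longrightarrow> emeasure \<mu> T = (\<integral>\<^sup>+z\<in>T. ennreal (u z) \<partial>area)"
  by (simp add: weighted_area_def emeasure_density)

lemma emeasure_\<sigma>: "T \<in> sets area \<Longrightarrow> emeasure \<sigma> T = (\<integral>\<^sup>+z\<in>T. ennreal (1 / u z) \<partial>area)"
  by (simp add: \<sigma>_def emeasure_density)

lemma disc_Int_ball_sets: "unit_disc \<inter> ball w r \<in> sets area"
  using borel_Int_disc_in_sets_area[of "ball w r"] by (simp add: Int_commute)

lemma ball_estimate:
  obtains C :: real where "C > 0"
    "\<And>w. w \<in> unit_disc \<Longrightarrow>
       emeasure \<mu> (unit_disc \<inter> ball w (3 * (1 - cmod w))) * emeasure \<sigma> (unit_disc \<inter> ball w (3 * (1 - cmod w)))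
       \<le> ennreal (C * (1 - cmod w) ^ 4)"
    "emeasure \<sigma> unit_disc \<le> ennreal C"
proof -
  obtain C :: real where C: "C > 0" "\<And>w. w \<in> unit_disc \<Longrightarrow>
       (\<integral>\<^sup>+z\<in>unit_disc \<inter> ball w (3 * (1 - cmod w)). ennreal (u z) \<partial>area) *
       (\<integral>\<^sup>+z\<in>unit_disc \<inter> ball w (3 * (1 - cmod w)). ennreal (1 / u z) \<partial>area)
       \<le> ennreal (C * (1 - cmod w) ^ 4)"
    "(\<integral>\<^sup>+z\<in>unit_disc. ennreal (u z) \<partial>area) * (\<integral>\<^sup>+z\<in>unit_disc. ennreal (1 / u z) \<partial>area) \<le> ennreal C"
    using B2_condition_ballD[OF B2] by blast
  have D: "unit_disc \<in> sets area" using sets.top[of area] by simp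
  \<comment> \<open>Total mass 1 turns the product bound on the whole disc into a bound on \<sigma>
    alone.\<close>
  have "emeasure \<mu> unit_disc = 1"
    using prob_space.emeasure_space_1[OF prob] by simp
  then show ?thesis
    using that[of C] C by (simp add: emeasure_\<mu>[OF D] emeasure_\<sigma>[OF D] emeasure_\<mu>[OF disc_Int_ball_sets] emeasure_\<sigma>[OF disc_Int_ball_sets])
qed

lemma finite_\<sigma>: "finite_measure \<sigma>"
proof -
  obtain C :: real where "emeasure \<sigma> unit_disc \<le> ennreal C" using ball_estimate by blast
  then show ?thesis by (intro finite_measureI) (auto simp: top_unique)
qed

text \<open>Cauchy-Schwarz for the factors g sqrt(u) and 1 / sqrt(u), whose product is g wherever u
  > 0.\<close>

lemma area_Cauchy_Schwarz:
  assumes [measurable]: "g \<in> borel_measurable area" "T \<in> sets area"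
  shows "(\<integral>\<^sup>+z\<in>T. g z \<partial>area)\<^sup>2 \<le> (\<integral>\<^sup>+z\<in>T. (g z)\<^sup>2 \<partial>\<mu>) * emeasure \<sigma> T"
proof -
  let ?a = "\<lambda>z. g z * ennreal (sqrt (u z)) * indicator T z"
  let ?b = "\<lambda>z. ennreal (1 / sqrt (u z)) * indicator T z"
  have "(\<integral>\<^sup>+z\<in>T. g z \<partial>area) = (\<integral>\<^sup>+z. ?a z * ?b z \<partial>area)"
    using u_pos
  proof (intro nn_integral_cong_AE, eventually_elim)
    case (elim z)
    then have "ennreal (sqrt (u z)) * ennreal (1 / sqrt (u z)) = 1"
      by (simp flip: ennreal_mult)
    then have "g z * ennreal (sqrt (u z)) * ennreal (1 / sqrt (u z)) = g z"
      by (simp add: mult.assoc)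
    then show ?case by (simp add: indicator_def)
  qed
  also have "\<dots>\<^sup>2 \<le> (\<integral>\<^sup>+z. (?a z)\<^sup>2 \<partial>area) * (\<integral>\<^sup>+z. (?b z)\<^sup>2 \<partial>area)"
    by (rule Cauchy_Schwarz_nn_integral) auto
  also have "(\<integral>\<^sup>+z. (?a z)\<^sup>2 \<partial>area) = (\<integral>\<^sup>+z\<in>T. (g z)\<^sup>2 \<partial>\<mu>)"
    using u_pos
    by (subst nn_integral_\<mu>, simp, intro nn_integral_cong_AE, eventually_elim)
       (auto simp: indicator_def power_mult_distrib ennreal_power mult.commute)
  also have "(\<integral>\<^sup>+z. (?b z)\<^sup>2 \<partial>area) = emeasure \<sigma> T"
    using u_pos
    by (subst emeasure_\<sigma>, simp, intro nn_integral_cong_AE, eventually_elim)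
       (auto simp: indicator_def ennreal_power power_divide)
  finally show ?thesis .
qed

text \<open>The squared norm with infinity as a possible value; \<open>A2_norm\<close> is 0 when the
  square is not integrable. Fubini and Fatou can thus be applied before membership in
  \<open>A2 u\<close> is known.\<close>

definition norm2 :: "(complex \<Rightarrow> complex) \<Rightarrow> ennreal" where
  "norm2 f = (\<integral>\<^sup>+z. ennreal ((cmod (f z))\<^sup>2) \<partial>\<mu>)"

text \<open>The squared sub-mean value inequality, so r^4 is the squared area of the disc. Keeping
  both factors on the right local is what lets B_2 act on a small disc in
  \<open>dilation_bound\<close>.\<close>

lemma local_pointwise_bound:
  assumes f: "f holomorphic_on unit_disc" and r: "r \<ge> 0" and sub: "ball a r \<subseteq> unit_disc"
  shows "ennreal ((cmod (f a))\<^sup>2) * ennreal (r ^ 4)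
    \<le> (\<integral>\<^sup>+z\<in>ball a r. ennreal ((cmod (f z))\<^sup>2) \<partial>\<mu>) * emeasure \<sigma> (ball a r)"
proof -
  have [measurable]: "f \<in> borel_measurable area" by (rule holomorphic_measurable_area[OF f])
  have B: "ball a r \<in> sets area"
    using borel_Int_disc_in_sets_area[of "ball a r"] sub by (simp add: Int_absorb2)
  have "ennreal ((cmod (f a))\<^sup>2) * ennreal (r ^ 4) = (ennreal (cmod (f a)) * ennreal (r\<^sup>2))\<^sup>2"
    using r by (simp add: power_mult_distrib ennreal_power flip: power_mult)
  also have "\<dots> \<le> (\<integral>\<^sup>+z\<in>ball a r. ennreal (cmod (f z)) \<partial>area)\<^sup>2"
    by (intro power_mono holomorphic_submean_area f sub r) auto
  also have "\<dots> \<le> (\<integral>\<^sup>+z\<in>ball a r. (ennreal (cmod (f z)))\<^sup>2 \<partial>\<mu>) * emeasure \<sigma> (ball a r)"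
    by (intro area_Cauchy_Schwarz B) auto
  finally show ?thesis by (simp add: ennreal_power)
qed

lemma pointwise_bound:
  obtains C :: real where "C > 0"
    "\<And>f a. f holomorphic_on unit_disc \<Longrightarrow> a \<in> unit_disc \<Longrightarrow>
       ennreal ((cmod (f a))\<^sup>2) * ennreal ((1 - cmod a) ^ 4) \<le> ennreal C * norm2 f"
proof -
  obtain C :: real where C: "C > 0" "emeasure \<sigma> unit_disc \<le> ennreal C" using ball_estimate by blast
  show ?thesis
  proof (rule that[OF C(1)])
    fix f a assume f: "f holomorphic_on unit_disc" and a: "a \<in> unit_disc"
    let ?B = "ball a (1 - cmod a)"
    have sub: "?B \<subseteq> unit_disc"
    proof
      fix z assume "z \<in> ?B"
      then show "z \<in> unit_disc"
        using norm_triangle_ineq2[of z a] by (simp add: dist_norm norm_minus_commute)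
    qed
    have "ennreal ((cmod (f a))\<^sup>2) * ennreal ((1 - cmod a) ^ 4)
      \<le> (\<integral>\<^sup>+z\<in>?B. ennreal ((cmod (f z))\<^sup>2) \<partial>\<mu>) * emeasure \<sigma> ?B"
      using a by (intro local_pointwise_bound f sub) auto
    also have "\<dots> \<le> norm2 f * emeasure \<sigma> unit_disc"
      unfolding norm2_def using sub sets.top[of \<sigma>]
      by (intro mult_mono nn_integral_mono emeasure_mono) (auto simp: indicator_def)
    also have "\<dots> \<le> norm2 f * ennreal C" by (intro mult_left_mono C) auto
    finally show "ennreal ((cmod (f a))\<^sup>2) * ennreal ((1 - cmod a) ^ 4) \<le> ennreal C * norm2 f"
      by (simp add: mult.commute)
  qed
qed

text \<open>The value \<open>f (r z)\<close> is controlled by the mean of \<open>f\<close> over the disc of radius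
  \<open>(1 - r \<bar>z\<bar>) / 2\<close> about \<open>r z\<close>.  After Fubini, the points \<open>z\<close> whose disc contains a given \<open>w\<close>,
  and the discs themselves, all lie within \<open>3 (1 - \<bar>w\<bar>)\<close> of \<open>w\<close>, where \<open>B\<^sub>2\<close> applies.\<close>

lemma dilation_bound:
  obtains C :: real where "C > 0"
    "\<And>f r. f holomorphic_on unit_disc \<Longrightarrow> 0 < r \<Longrightarrow> r < 1 \<Longrightarrow>
       norm2 (\<lambda>z. f (of_real r * z)) \<le> ennreal C * norm2 f"
proof -
  obtain C :: real where C: "C > 0" and est: "\<And>w. w \<in> unit_disc \<Longrightarrow>
       emeasure \<mu> (unit_disc \<inter> ball w (3 * (1 - cmod w))) * emeasure \<sigma> (unit_disc \<inter> ball w (3 * (1 - cmod w)))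
       \<le> ennreal (C * (1 - cmod w) ^ 4)" using ball_estimate by blast
  interpret \<mu>: prob_space \<mu> by (rule prob)
  interpret \<sigma>: finite_measure \<sigma> by (rule finite_\<sigma>)
  interpret \<mu>\<mu>: pair_sigma_finite \<mu> \<mu> ..
  have id: "(\<lambda>z. z) \<in> borel_measurable area"
    by (intro borel_measurable_area_continuous continuous_intros)
  \<comment> \<open>The factor 81 is 3^4, from replacing \<rho> z by h / 3 in 1 / \<rho>^4
    below.\<close>
  have K: "81 * C > 0" using C by simp
  show ?thesis
  proof (rule that[OF K])
    fix f and r :: real
    assume f: "f holomorphic_on unit_disc" and r: "0 < r" "r < 1"
    define \<rho> where "\<rho> z = (1 - r * cmod z) / 2" for z
    define P where "P z w \<longleftrightarrow> cmod (w - of_real r * z) < \<rho> z" for z w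
    define V where "V z = emeasure \<sigma> (ball (of_real r * z) (\<rho> z))" for z
    have [measurable]: "f \<in> borel_measurable area" by (rule holomorphic_measurable_area[OF f])
    have id\<mu>: "(\<lambda>z. z) \<in> borel_measurable \<mu>" and id\<sigma>: "(\<lambda>z. z) \<in> borel_measurable \<sigma>"
      using id by simp_all
    have \<rho>_pos: "\<rho> z > 0" "r * cmod z < 1" if "z \<in> unit_disc" for z
    proof -
      have "r * cmod z \<le> 1 * cmod z" using r by (intro mult_right_mono) auto
      then show "r * cmod z < 1" using that by simp
      then show "\<rho> z > 0" by (simp add: \<rho>_def)
    qed
    have sub: "ball (of_real r * z) (\<rho> z) \<subseteq> unit_disc" if "z \<in> unit_disc" for z
    proof
      fix w assume "w \<in> ball (of_real r * z) (\<rho> z)"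
      then have "cmod (w - of_real r * z) < \<rho> z" by (simp add: dist_norm norm_minus_commute)
      moreover have "cmod w \<le> cmod (w - of_real r * z) + cmod (of_real r * z)"
        using norm_triangle_ineq[of "w - of_real r * z" "of_real r * z"] by simp
      moreover have "cmod (of_real r * z) = r * cmod z" using r by (simp add: norm_mult)
      ultimately show "w \<in> unit_disc" using \<rho>_pos[OF that] by (simp add: \<rho>_def)
    qed
    have [measurable]: "(\<lambda>p. fst p) \<in> borel_measurable (\<mu> \<Otimes>\<^sub>M N)" for N :: "complex measure"
      by (rule measurable_compose[OF measurable_fst id\<mu>])
    have [measurable]: "(\<lambda>p. snd p) \<in> borel_measurable (\<mu> \<Otimes>\<^sub>M \<mu>)"
        "(\<lambda>p. snd p) \<in> borel_measurable (\<mu> \<Otimes>\<^sub>M \<sigma>)"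
      by (rule measurable_compose[OF measurable_snd id\<mu>], rule measurable_compose[OF measurable_snd id\<sigma>])
    have P\<mu>: "Measurable.pred (\<mu> \<Otimes>\<^sub>M \<mu>) (\<lambda>p. P (fst p) (snd p))"
      and P\<sigma>: "Measurable.pred (\<mu> \<Otimes>\<^sub>M \<sigma>) (\<lambda>p. P (fst p) (snd p))"
      unfolding P_def \<rho>_def by measurable
    have \<rho>_meas [measurable]: "\<rho> \<in> borel_measurable \<mu>"
      unfolding \<rho>_def using id\<mu> by measurable
    \<comment> \<open>Fubini requires \<open>V\<close> to be measurable although its disc moves with
      z: the discs are the sections of one measurable subset of the product.\<close>
    have "(\<lambda>z. emeasure \<sigma> (Pair z -` {p \<in> space (\<mu> \<Otimes>\<^sub>M \<sigma>). P (fst p) (snd p)})) \<in> borel_measurable \<mu>"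
      using P\<sigma> by (intro \<sigma>.measurable_emeasure_Pair) (simp add: pred_def)
    also have "?this \<longleftrightarrow> V \<in> borel_measurable \<mu>"
    proof (rule measurable_cong)
      fix z assume z: "z \<in> space \<mu>"
      have "Pair z -` {p \<in> space (\<mu> \<Otimes>\<^sub>M \<sigma>). P (fst p) (snd p)} = ball (of_real r * z) (\<rho> z)"
        using sub[of z] z by (auto simp: space_pair_measure P_def dist_norm norm_minus_commute)
      then show "emeasure \<sigma> (Pair z -` {p \<in> space (\<mu> \<Otimes>\<^sub>M \<sigma>). P (fst p) (snd p)}) = V z"
        by (simp add: V_def)
    qed
    finally have [measurable]: "V \<in> borel_measurable \<mu>" .
    \<comment> \<open>For fixed z this integrates in w to the local bound on |f(r z)|^2. Encoding
      the disc by the relation \<open>P\<close> lets Fubini read it from the side of w.\<close>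
    define G where "G z w = ennreal (1 / \<rho> z ^ 4) * V z * ennreal ((cmod (f w))\<^sup>2) * (if P z w then 1 else 0)" for z w
    have "norm2 (\<lambda>z. f (of_real r * z)) \<le> (\<integral>\<^sup>+z. \<integral>\<^sup>+w. G z w \<partial>\<mu> \<partial>\<mu>)"
      unfolding norm2_def
    proof (rule nn_integral_mono)
      fix z assume "z \<in> space \<mu>"
      then have z: "z \<in> unit_disc" by simp
      let ?B = "ball (of_real r * z) (\<rho> z)"
      have "ennreal ((cmod (f (of_real r * z)))\<^sup>2)
          = (ennreal ((cmod (f (of_real r * z)))\<^sup>2) * ennreal (\<rho> z ^ 4)) * ennreal (1 / \<rho> z ^ 4)"
        using \<rho>_pos[OF z] by (simp flip: ennreal_mult)
      also have "\<dots> \<le> ((\<integral>\<^sup>+w\<in>?B. ennreal ((cmod (f w))\<^sup>2) \<partial>\<mu>) * V z) * ennreal (1 / \<rho> z ^ 4)"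
        unfolding V_def using \<rho>_pos[OF z] by (intro mult_right_mono local_pointwise_bound f sub z) auto
      also have "\<dots> = (ennreal (1 / \<rho> z ^ 4) * V z) * (\<integral>\<^sup>+w\<in>?B. ennreal ((cmod (f w))\<^sup>2) \<partial>\<mu>)"
        by (simp add: mult_ac)
      also have "\<dots> = (\<integral>\<^sup>+w. G z w \<partial>\<mu>)"
      proof (subst nn_integral_cmult[symmetric])
        have "?B \<in> sets area"
          using borel_Int_disc_in_sets_area[of ?B] sub[OF z] by (simp add: Int_absorb2)
        then show "(\<lambda>w. ennreal ((cmod (f w))\<^sup>2) * indicator ?B w) \<in> borel_measurable \<mu>" by measurable
        show "(\<integral>\<^sup>+ w. ennreal (1 / \<rho> z ^ 4) * V z * (ennreal ((cmod (f w))\<^sup>2) * indicator ?B w) \<partial>\<mu>) = (\<integral>\<^sup>+w. G z w \<partial>\<mu>)"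
          by (intro nn_integral_cong)
            (auto simp: G_def P_def indicator_def dist_norm norm_minus_commute mult.assoc)
      qed
      finally show "ennreal ((cmod (f (of_real r * z)))\<^sup>2) \<le> (\<integral>\<^sup>+w. G z w \<partial>\<mu>)" .
    qed
    also have "\<dots> = (\<integral>\<^sup>+w. \<integral>\<^sup>+z. G z w \<partial>\<mu> \<partial>\<mu>)"
    proof (rule \<mu>\<mu>.Fubini'[symmetric])
      have "(\<lambda>p. ennreal (1 / \<rho> (fst p) ^ 4) * V (fst p) * ennreal ((cmod (f (snd p)))\<^sup>2) * (if P (fst p) (snd p) then 1 else 0))
        \<in> borel_measurable (\<mu> \<Otimes>\<^sub>M \<mu>)"
        using P\<mu> by measurable
      then show "case_prod G \<in> borel_measurable (\<mu> \<Otimes>\<^sub>M \<mu>)" by (simp add: G_def case_prod_beta')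
    qed
    also have "\<dots> \<le> (\<integral>\<^sup>+w. ennreal (81 * C) * ennreal ((cmod (f w))\<^sup>2) \<partial>\<mu>)"
    proof (rule nn_integral_mono)
      fix w assume "w \<in> space \<mu>"
      then have w: "w \<in> unit_disc" by simp
      define h where "h = 1 - cmod w"
      have h: "h > 0" using w by (simp add: h_def)
      let ?T = "unit_disc \<inter> ball w (3 * h)"
      let ?c = "ennreal (81 / h ^ 4) * emeasure \<sigma> ?T * ennreal ((cmod (f w))\<^sup>2)"
      have "(\<integral>\<^sup>+z. G z w \<partial>\<mu>) \<le> (\<integral>\<^sup>+z. ?c * indicator ?T z \<partial>\<mu>)"
      proof (rule nn_integral_mono)
        fix z assume "z \<in> space \<mu>"
        then have z: "z \<in> unit_disc" by simp
        show "G z w \<le> ?c * indicator ?T z"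
        proof (cases "P z w")
          case True
          then have wz: "cmod (w - of_real r * z) < \<rho> z" by (simp add: P_def)
          have nrz: "cmod (of_real r * z) = r * cmod z" using r by (simp add: norm_mult)
          \<comment> \<open>Since 1 - |r z| = 2 \<rho> and |w - r z| < \<rho>, the distance h of w
            to the circle lies between \<rho> and 3 \<rho>.\<close>
          have "cmod w \<le> cmod (of_real r * z) + cmod (w - of_real r * z)"
            using norm_triangle_ineq[of "of_real r * z" "w - of_real r * z"] by simp
          then have h1: "\<rho> z \<le> h"
            using wz nrz by (simp add: h_def \<rho>_def)
          have "cmod (of_real r * z) \<le> cmod w + cmod (w - of_real r * z)"
            using norm_triangle_ineq4[of w "w - of_real r * z"] by simp
          then have h2: "h / 3 \<le> \<rho> z"
            using h wz nrz unfolding h_def \<rho>_def by argo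
          \<comment> \<open>This is the origin of the radius 3 h: z is within 2 \<rho> of r z, which
            is within \<rho> of w, and \<rho> \<le> h.\<close>
          have "cmod (of_real r * z - z) = (1 - r) * cmod z"
          proof -
            have "of_real r * z - z = of_real (r - 1) * z" by (simp add: algebra_simps)
            then show ?thesis using r by (simp only: norm_mult norm_of_real) simp
          qed
          also have "\<dots> \<le> 1 - r * cmod z" using z by (simp add: algebra_simps)
          finally have "cmod (of_real r * z - z) \<le> 2 * \<rho> z" by (simp add: \<rho>_def)
          moreover have "cmod (w - z) \<le> cmod (w - of_real r * z) + cmod (of_real r * z - z)"
            using norm_triangle_ineq[of "w - of_real r * z" "of_real r * z - z"] by simp
          ultimately have "cmod (w - z) < 3 * h" using wz h1 by linarith
          then have zT: "z \<in> ?T" using z by (simp add: dist_norm)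
          have "ball (of_real r * z) (\<rho> z) \<subseteq> ?T"
          proof
            fix v assume v: "v \<in> ball (of_real r * z) (\<rho> z)"
            then have "cmod (of_real r * z - v) < \<rho> z" by (simp add: dist_norm)
            moreover have "cmod (w - v) \<le> cmod (w - of_real r * z) + cmod (of_real r * z - v)"
              using norm_triangle_ineq[of "w - of_real r * z" "of_real r * z - v"] by simp
            ultimately have "cmod (w - v) < 3 * h" using wz h1 h by linarith
            then show "v \<in> ?T" using sub[OF z] v by (auto simp: dist_norm)
          qed
          then have V: "V z \<le> emeasure \<sigma> ?T"
            unfolding V_def using disc_Int_ball_sets by (intro emeasure_mono) (auto simp: sets_\<sigma>)
          have "(h / 3) ^ 4 \<le> \<rho> z ^ 4" using h h2 by (intro power_mono) auto
          then have "1 / \<rho> z ^ 4 \<le> 1 / (h / 3) ^ 4" using h by (intro frac_le) auto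
          also have "\<dots> = 81 / h ^ 4" by (simp add: power_divide)
          finally have "ennreal (1 / \<rho> z ^ 4) \<le> ennreal (81 / h ^ 4)" by (rule ennreal_leI)
          then have "ennreal (1 / \<rho> z ^ 4) * V z * ennreal ((cmod (f w))\<^sup>2) \<le> ?c"
            by (intro mult_right_mono mult_mono V) auto
          then show ?thesis using True zT by (simp add: G_def)
        qed (simp add: G_def)
      qed
      also have "\<dots> = ?c * emeasure \<mu> ?T"
        using disc_Int_ball_sets by (intro nn_integral_cmult_indicator) (simp add: sets_\<mu>)
      \<comment> \<open>Integration over z supplied \<mu>(T) and Cauchy-Schwarz supplied
        \<sigma>(T), for the same T. By B_2 their product cancels h^4.\<close>
      also have "\<dots> = ennreal (81 / h ^ 4) * (emeasure \<mu> ?T * emeasure \<sigma> ?T) * ennreal ((cmod (f w))\<^sup>2)"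
        by (simp add: mult_ac)
      also have "\<dots> \<le> ennreal (81 / h ^ 4) * ennreal (C * h ^ 4) * ennreal ((cmod (f w))\<^sup>2)"
        using est[OF w] by (intro mult_right_mono mult_left_mono) (auto simp: h_def)
      also have "ennreal (81 / h ^ 4) * ennreal (C * h ^ 4) = ennreal (81 * C)"
        using h C by (simp flip: ennreal_mult)
      finally show "(\<integral>\<^sup>+z. G z w \<partial>\<mu>) \<le> ennreal (81 * C) * ennreal ((cmod (f w))\<^sup>2)" .
    qed
    also have "\<dots> = ennreal (81 * C) * norm2 f"
      unfolding norm2_def by (rule nn_integral_cmult) measurable
    finally show "norm2 (\<lambda>z. f (of_real r * z)) \<le> ennreal (81 * C) * norm2 f" .
  qed
qed

text \<open>A uniformly close polynomial is compared with the dilation under both measures. Each has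
  mass 1, so an error \<epsilon> costs a multiple of \<epsilon>^2. The factor 4 comes from using
  |a|^2 \<le> 2 |b|^2 + 2 \<epsilon>^2 once for each measure.\<close>

lemma carleson_dilation:
  assumes \<nu>: "prob_space \<nu>" and sets: "sets \<nu> = sets (restrict_space borel unit_disc)"
    and C: "C > 0" "\<And>p::complex poly. (\<integral>\<^sup>+z. ennreal ((cmod (poly p z))\<^sup>2) \<partial>\<nu>) \<le> ennreal C * norm2 (poly p)"
    and f: "f holomorphic_on unit_disc" and r: "0 < r" "r < 1"
  shows "(\<integral>\<^sup>+z. ennreal ((cmod (f (of_real r * z)))\<^sup>2) \<partial>\<nu>) \<le> ennreal (4 * C) * norm2 (\<lambda>z. f (of_real r * z))"
proof (rule ennreal_le_epsilon)
  interpret \<nu>: prob_space \<nu> by (rule \<nu>)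
  interpret \<mu>: prob_space \<mu> by (rule prob)
  define g where "g z = f (of_real r * z)" for z
  have g: "g holomorphic_on unit_disc" using holomorphic_dilation[OF f r] by (simp add: g_def[abs_def])
  have space: "space \<nu> = unit_disc" using sets_eq_imp_space_eq[OF sets] by (simp add: space_restrict_space)
  have hol_meas: "k \<in> borel_measurable \<nu>" if "k holomorphic_on unit_disc" for k
    using borel_measurable_continuous_on_restrict[OF holomorphic_on_imp_continuous_on[OF that]] sets
    by (simp cong: measurable_cong_sets)
  fix e :: real assume e: "e > 0"
  \<comment> \<open>The accumulated error is 2 C (2 \<epsilon>^2) + 2 \<epsilon>^2, which this
    choice makes equal to e.\<close>
  define \<epsilon> where "\<epsilon> = sqrt (e / (4 * C + 2))"
  have \<epsilon>: "\<epsilon> > 0" "(4 * C + 2) * \<epsilon>\<^sup>2 = e" using e C by (auto simp: \<epsilon>_def)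
  obtain p :: "complex poly" where p: "\<And>z. z \<in> unit_disc \<Longrightarrow> cmod (poly p z - g z) \<le> \<epsilon>"
    using dilation_polynomial_approx[OF f r \<epsilon>(1)] unfolding g_def by blast
  have ineq: "ennreal ((cmod a)\<^sup>2) \<le> 2 * ennreal ((cmod b)\<^sup>2) + ennreal (2 * \<epsilon>\<^sup>2)"
    if "cmod (b - a) \<le> \<epsilon>" for a b :: complex
  proof -
    have "cmod a \<le> cmod b + \<epsilon>"
      using that norm_triangle_ineq4[of b "b - a"] by simp
    then have "(cmod a)\<^sup>2 \<le> (cmod b + \<epsilon>)\<^sup>2" by (intro power_mono) auto
    also have "\<dots> \<le> 2 * (cmod b)\<^sup>2 + 2 * \<epsilon>\<^sup>2"
      using sum_squares_bound[of "cmod b" \<epsilon>] by (simp add: power2_sum)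
    finally have "ennreal ((cmod a)\<^sup>2) \<le> ennreal (2 * (cmod b)\<^sup>2 + 2 * \<epsilon>\<^sup>2)" by (rule ennreal_leI)
    also have "ennreal (2 * (cmod b)\<^sup>2 + 2 * \<epsilon>\<^sup>2) = 2 * ennreal ((cmod b)\<^sup>2) + ennreal (2 * \<epsilon>\<^sup>2)"
      by (simp add: ennreal_mult')
    finally show ?thesis .
  qed
  have poly_hol: "poly p holomorphic_on unit_disc" by (intro holomorphic_intros)
  have [measurable]: "poly p \<in> borel_measurable \<nu>" by (rule hol_meas[OF poly_hol])
  have [measurable]: "g \<in> borel_measurable area" by (rule holomorphic_measurable_area[OF g])
  have "norm2 (poly p) \<le> (\<integral>\<^sup>+z. 2 * ennreal ((cmod (g z))\<^sup>2) + ennreal (2 * \<epsilon>\<^sup>2) \<partial>\<mu>)"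
    unfolding norm2_def using p by (intro nn_integral_mono ineq) (auto simp: norm_minus_commute)
  also have "\<dots> = 2 * norm2 g + ennreal (2 * \<epsilon>\<^sup>2)"
    unfolding norm2_def
    by (subst nn_integral_add) (auto simp: nn_integral_cmult \<mu>.emeasure_space_1[simplified])
  finally have np: "norm2 (poly p) \<le> 2 * norm2 g + ennreal (2 * \<epsilon>\<^sup>2)" .
  have "(\<integral>\<^sup>+z. ennreal ((cmod (g z))\<^sup>2) \<partial>\<nu>) \<le> (\<integral>\<^sup>+z. 2 * ennreal ((cmod (poly p z))\<^sup>2) + ennreal (2 * \<epsilon>\<^sup>2) \<partial>\<nu>)"
    using p space by (intro nn_integral_mono ineq) auto
  also have "\<dots> = 2 * (\<integral>\<^sup>+z. ennreal ((cmod (poly p z))\<^sup>2) \<partial>\<nu>) + ennreal (2 * \<epsilon>\<^sup>2)"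
    by (subst nn_integral_add) (auto simp: nn_integral_cmult \<nu>.emeasure_space_1)
  also have "\<dots> \<le> 2 * (ennreal C * norm2 (poly p)) + ennreal (2 * \<epsilon>\<^sup>2)"
    by (intro add_right_mono mult_left_mono C) auto
  also have "\<dots> \<le> 2 * (ennreal C * (2 * norm2 g + ennreal (2 * \<epsilon>\<^sup>2))) + ennreal (2 * \<epsilon>\<^sup>2)"
    by (intro add_right_mono mult_left_mono np) auto
  also have "2 * (ennreal C * (2 * norm2 g + ennreal (2 * \<epsilon>\<^sup>2))) + ennreal (2 * \<epsilon>\<^sup>2)
      = ennreal (4 * C) * norm2 g + (ennreal (4 * C * \<epsilon>\<^sup>2) + ennreal (2 * \<epsilon>\<^sup>2))"
  proof -
    have "ennreal (4 * C) = 4 * ennreal C" "ennreal (2 * \<epsilon>\<^sup>2) = 2 * ennreal (\<epsilon>\<^sup>2)"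
      "ennreal (4 * C * \<epsilon>\<^sup>2) = 4 * ennreal C * ennreal (\<epsilon>\<^sup>2)"
      using C by (simp_all add: ennreal_mult')
    then show ?thesis by (simp add: distrib_left mult.assoc mult.left_commute)
  qed
  also have "ennreal (4 * C * \<epsilon>\<^sup>2) + ennreal (2 * \<epsilon>\<^sup>2) = ennreal e"
    using C \<epsilon> by (subst ennreal_plus[symmetric]) (auto simp: distrib_right)
  finally show "(\<integral>\<^sup>+z. ennreal ((cmod (f (of_real r * z)))\<^sup>2) \<partial>\<nu>)
      \<le> ennreal (4 * C) * norm2 (\<lambda>z. f (of_real r * z)) + ennreal e"
    by (simp add: g_def[abs_def])
qed

lemma carleson_holomorphic:
  assumes \<nu>: "prob_space \<nu>" and sets: "sets \<nu> = sets (restrict_space borel unit_disc)"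
    and carl: "carleson_measure \<nu> \<mu>"
  obtains C :: real where "C > 0"
    "\<And>f. f holomorphic_on unit_disc \<Longrightarrow> (\<integral>\<^sup>+z. ennreal ((cmod (f z))\<^sup>2) \<partial>\<nu>) \<le> ennreal C * norm2 f"
proof -
  obtain C :: real where C: "C > 0" "\<And>p::complex poly. (\<integral>\<^sup>+z. ennreal ((cmod (poly p z))\<^sup>2) \<partial>\<nu>) \<le> ennreal C * norm2 (poly p)"
    using carl unfolding carleson_measure_def norm2_def by blast
  obtain D :: real where D: "D > 0" "\<And>f r. f holomorphic_on unit_disc \<Longrightarrow> 0 < r \<Longrightarrow> r < 1 \<Longrightarrow>
       norm2 (\<lambda>z. f (of_real r * z)) \<le> ennreal D * norm2 f" using dilation_bound by blast
  have space: "space \<nu> = unit_disc" using sets_eq_imp_space_eq[OF sets] by (simp add: space_restrict_space)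
  have hol_meas: "k \<in> borel_measurable \<nu>" if "k holomorphic_on unit_disc" for k
    using borel_measurable_continuous_on_restrict[OF holomorphic_on_imp_continuous_on[OF that]] sets
    by (simp cong: measurable_cong_sets)
  \<comment> \<open>The offset 2 makes the first radius 1/2; with offset 1 it would be 0.\<close>
  define r :: "nat \<Rightarrow> real" where "r n = 1 - 1 / (real n + 2)" for n
  have r: "0 < r n" "r n < 1" for n by (auto simp: r_def field_simps)
  have rlim: "r \<longlonglongrightarrow> 1" unfolding r_def by real_asymp
  have CD: "4 * C * D > 0" using C D by simp
  show ?thesis
  proof (rule that[OF CD])
    fix f assume f: "f holomorphic_on unit_disc"
    have [measurable]: "(\<lambda>z. f (of_real (r n) * z)) \<in> borel_measurable \<nu>" for n
      by (intro hol_meas holomorphic_dilation f r)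
    have "(\<integral>\<^sup>+z. ennreal ((cmod (f z))\<^sup>2) \<partial>\<nu>)
        = (\<integral>\<^sup>+z. liminf (\<lambda>n. ennreal ((cmod (f (of_real (r n) * z)))\<^sup>2)) \<partial>\<nu>)"
    proof (rule nn_integral_cong)
      fix z assume "z \<in> space \<nu>"
      then have z: "z \<in> unit_disc" by (simp add: space)
      have "isCont f z"
        using holomorphic_on_imp_continuous_on[OF f] z by (simp add: continuous_on_eq_continuous_at)
      moreover have "(\<lambda>n. of_real (r n) * z) \<longlonglongrightarrow> of_real 1 * z" by (intro tendsto_intros rlim)
      ultimately have "(\<lambda>n. f (of_real (r n) * z)) \<longlonglongrightarrow> f z"
        by (intro isCont_tendsto_compose[of z f]) simp_all
      then have "(\<lambda>n. ennreal ((cmod (f (of_real (r n) * z)))\<^sup>2)) \<longlonglongrightarrow> ennreal ((cmod (f z))\<^sup>2)"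
        by (intro tendsto_intros)
      then show "ennreal ((cmod (f z))\<^sup>2) = liminf (\<lambda>n. ennreal ((cmod (f (of_real (r n) * z)))\<^sup>2))"
        by (rule lim_imp_Liminf[OF sequentially_bot, symmetric])
    qed
    also have "\<dots> \<le> liminf (\<lambda>n. \<integral>\<^sup>+z. ennreal ((cmod (f (of_real (r n) * z)))\<^sup>2) \<partial>\<nu>)"
      by (rule nn_integral_liminf) measurable
    also have "\<dots> \<le> ennreal (4 * C * D) * norm2 f"
    proof (rule Liminf_le, simp, rule always_eventually, rule allI)
      fix n
      have "(\<integral>\<^sup>+z. ennreal ((cmod (f (of_real (r n) * z)))\<^sup>2) \<partial>\<nu>)
          \<le> ennreal (4 * C) * norm2 (\<lambda>z. f (of_real (r n) * z))"
        by (intro carleson_dilation \<nu> sets C f r)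
      also have "\<dots> \<le> ennreal (4 * C) * (ennreal D * norm2 f)"
        by (intro mult_left_mono D f r) auto
      also have "\<dots> = ennreal (4 * C * D) * norm2 f"
        using C D by (simp add: ennreal_mult mult.assoc)
      finally show "(\<integral>\<^sup>+z. ennreal ((cmod (f (of_real (r n) * z)))\<^sup>2) \<partial>\<nu>) \<le> ennreal (4 * C * D) * norm2 f" .
    qed
    finally show "(\<integral>\<^sup>+z. ennreal ((cmod (f z))\<^sup>2) \<partial>\<nu>) \<le> ennreal (4 * C * D) * norm2 f" .
  qed
qed

end

section \<open>Riesz representation\<close>

text \<open>The first-order condition at a minimum; in \<open>Riesz_representation\<close> it
  identifies the minimiser with the representing vector.\<close>

lemma quadratic_nonneg_imp_linear_zero:
  fixes X N :: real
  assumes N: "N \<ge> 0" and nn: "\<And>t. 0 \<le> 2 * t * X + t\<^sup>2 * N"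
  shows "X = 0"
proof (rule ccontr)
  assume X: "X \<noteq> 0"
  \<comment> \<open>The vertex of the parabola is - X / N; N + 1 in the denominator avoids a split
    on N = 0 and still gives a negative value.\<close>
  have "2 * (- X / (N + 1)) * X + (- X / (N + 1))\<^sup>2 * N = - (X\<^sup>2 * (N + 2)) / (N + 1)\<^sup>2"
    using N by (simp add: divide_simps) algebra
  moreover have "X\<^sup>2 * (N + 2) / (N + 1)\<^sup>2 > 0"
    using N X by (intro divide_pos_pos mult_pos_pos) auto
  ultimately show False using nn[of "- X / (N + 1)"] by simp
qed

text \<open>A complete semi-inner product on a space of functions.  Only a semi-inner product is
  required because functions that agree on the relevant domain need not be equal.\<close>

locale complete_function_space =
  fixes V :: "('b \<Rightarrow> complex) set" and ip :: "('b \<Rightarrow> complex) \<Rightarrow> ('b \<Rightarrow> complex) \<Rightarrow> complex"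
  assumes zero_mem: "(\<lambda>_. 0) \<in> V"
    and add_mem [simp]: "f \<in> V \<Longrightarrow> g \<in> V \<Longrightarrow> (\<lambda>x. f x + g x) \<in> V"
    and scale_mem [simp]: "f \<in> V \<Longrightarrow> (\<lambda>x. c * f x) \<in> V"
    and ip_add: "f \<in> V \<Longrightarrow> g \<in> V \<Longrightarrow> h \<in> V \<Longrightarrow> ip (\<lambda>x. f x + g x) h = ip f h + ip g h"
    and ip_scale: "f \<in> V \<Longrightarrow> h \<in> V \<Longrightarrow> ip (\<lambda>x. c * f x) h = c * ip f h"
    and ip_cnj: "f \<in> V \<Longrightarrow> g \<in> V \<Longrightarrow> ip g f = cnj (ip f g)"
    and ip_nonneg: "f \<in> V \<Longrightarrow> 0 \<le> Re (ip f f)"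
    and complete: "(\<And>k::nat. s k \<in> V) \<Longrightarrow>
      (\<And>e. e > 0 \<Longrightarrow> \<exists>N. \<forall>k\<ge>N. \<forall>l\<ge>N. Re (ip (\<lambda>x. s k x - s l x) (\<lambda>x. s k x - s l x)) < e) \<Longrightarrow>
      \<exists>h\<in>V. (\<lambda>k. Re (ip (\<lambda>x. s k x - h x) (\<lambda>x. s k x - h x))) \<longlonglongrightarrow> 0"
begin

definition sqn :: "('b \<Rightarrow> complex) \<Rightarrow> real" where "sqn f = Re (ip f f)"

lemma sqn_nonneg: "f \<in> V \<Longrightarrow> 0 \<le> sqn f"
  unfolding sqn_def by (rule ip_nonneg)

lemma diff_mem [simp]:
  assumes "f \<in> V" "g \<in> V"
  shows "(\<lambda>x. f x - g x) \<in> V"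
  using add_mem[OF assms(1) scale_mem[OF assms(2), of "-1"]] by simp

lemma ip_diff_right:
  assumes "f \<in> V" "g \<in> V" "h \<in> V"
  shows "ip h (\<lambda>x. f x - g x) = ip h f - ip h g"
proof -
  have "ip (\<lambda>x. f x - g x) h = ip f h - ip g h"
    using ip_add[OF assms(1) scale_mem[OF assms(2)] assms(3), of "-1"] ip_scale[OF assms(2,3), of "-1"]
    by simp
  then show ?thesis
    using assms by (simp add: ip_cnj[of "\<lambda>x. f x - g x" h] ip_cnj[of f h] ip_cnj[of g h])
qed

lemma sqn_add_scale:
  assumes f: "f \<in> V" and g: "g \<in> V"
  shows "sqn (\<lambda>x. f x + c * g x) = sqn f + 2 * Re (c * ip g f) + (cmod c)\<^sup>2 * sqn g"
proof -
  have expand: "ip (\<lambda>x. f x + c * g x) k = ip f k + c * ip g k" if "k \<in> V" for k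
    using f g that by (simp add: ip_add ip_scale)
  have right: "ip k (\<lambda>x. f x + c * g x) = ip k f + cnj c * ip k g" if k: "k \<in> V" for k
    using expand[OF k] f g k
    by (simp add: ip_cnj[of "\<lambda>x. f x + c * g x" k] ip_cnj[of f k] ip_cnj[of g k])
  have "ip (\<lambda>x. f x + c * g x) (\<lambda>x. f x + c * g x)
      = ip f f + cnj c * ip f g + c * (ip g f + cnj c * ip g g)"
    using f g by (simp add: expand right)
  also have "\<dots> = ip f f + (cnj (c * ip g f) + c * ip g f) + of_real ((cmod c)\<^sup>2) * ip g g"
    unfolding complex_norm_square using ip_cnj[OF g f] by (simp add: algebra_simps)
  finally show ?thesis
    by (simp add: sqn_def)
qed

text \<open>The squared seminorm of w + t v is nonnegative for all real t. A vector of seminorm 0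
  may be a nonzero function, hence the separate degenerate case.\<close>

lemma Re_ip_Cauchy_Schwarz:
  assumes v: "v \<in> V" and w: "w \<in> V"
  shows "(Re (ip v w))\<^sup>2 \<le> sqn v * sqn w"
proof -
  let ?R = "Re (ip v w)"
  have nn: "0 \<le> sqn w + 2 * t * ?R + t\<^sup>2 * sqn v" for t :: real
    using sqn_nonneg[of "\<lambda>x. w x + of_real t * v x"] sqn_add_scale[OF w v, of "of_real t"] v w
    by simp
  show ?thesis
  proof (cases "sqn v = 0")
    case True
    have "?R = 0"
    proof (rule ccontr)
      assume "?R \<noteq> 0"
      \<comment> \<open>When \<open>sqn v = 0\<close> the expression is affine in t, and at this t
        it equals -1.\<close>
      then have "2 * (- (sqn w + 1) / (2 * ?R)) * ?R = - (sqn w + 1)" by simp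
      then show False using nn[of "- (sqn w + 1) / (2 * ?R)"] True by simp
    qed
    then show ?thesis by (simp add: True)
  next
    case False
    then have pos: "sqn v > 0" using sqn_nonneg[OF v] by simp
    have "sqn w + 2 * (- ?R / sqn v) * ?R + (- ?R / sqn v)\<^sup>2 * sqn v = sqn w - ?R\<^sup>2 / sqn v"
      using pos by (simp add: field_simps power2_eq_square)
    then have "?R\<^sup>2 / sqn v \<le> sqn w" using nn[of "- ?R / sqn v"] by simp
    then show ?thesis using pos by (simp add: field_simps)
  qed
qed

text \<open>Variational proof: if h represents \<Phi>, completing the square gives J f = sqn (f - h)
  - sqn h, so h has to be a minimiser of \<open>J\<close>. Conversely, limits of minimising
  sequences are shown to represent \<Phi>.\<close>

lemma Riesz_representation:
  assumes \<Phi>_add: "\<And>f g. f \<in> V \<Longrightarrow> g \<in> V \<Longrightarrow> \<Phi> (\<lambda>x. f x + g x) = \<Phi> f + \<Phi> g"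
    and \<Phi>_scale: "\<And>c f. f \<in> V \<Longrightarrow> \<Phi> (\<lambda>x. c * f x) = c * \<Phi> f"
    and \<Phi>_bound: "\<And>f. f \<in> V \<Longrightarrow> (cmod (\<Phi> f))\<^sup>2 \<le> M * sqn f" and M: "M \<ge> 0"
  obtains h where "h \<in> V" "\<And>g. g \<in> V \<Longrightarrow> \<Phi> g = ip g h" "sqn h \<le> M"
proof -
  define J where "J f = sqn f - 2 * Re (\<Phi> f)" for f
  have \<Phi>_lin: "\<Phi> (\<lambda>x. f x + c * g x) = \<Phi> f + c * \<Phi> g" if "f \<in> V" "g \<in> V" for f g c
    using that by (simp add: \<Phi>_add \<Phi>_scale)
  have J_ge: "- M \<le> J f" if f: "f \<in> V" for f
  proof -
    \<comment> \<open>The arithmetic-geometric mean inequality; it gives 2 |\<Phi> f| \<le> M + sqn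
      f and so bounds \<open>J\<close> below.\<close>
    have "M * sqn f \<le> ((M + sqn f) / 2)\<^sup>2"
      using sum_squares_ge_zero[of "M - sqn f" 0] by (simp add: power2_eq_square field_simps)
    with \<Phi>_bound[OF f] have "(cmod (\<Phi> f))\<^sup>2 \<le> ((M + sqn f) / 2)\<^sup>2" by linarith
    then have "cmod (\<Phi> f) \<le> (M + sqn f) / 2"
      using M sqn_nonneg[OF f] by (auto intro: power2_le_imp_le)
    then show ?thesis using complex_Re_le_cmod[of "\<Phi> f"] by (simp add: J_def)
  qed
  define m where "m = (INF f\<in>V. J f)"
  have bdd: "bdd_below (J ` V)" using J_ge by (intro bdd_belowI2)
  have m_le: "m \<le> J f" if "f \<in> V" for f
    unfolding m_def using bdd that by (rule cINF_lower)
  have "\<exists>f\<in>V. J f < m + 1 / real (Suc k)" for k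
    using cINF_less_iff[OF _ bdd, of "m + 1 / real (Suc k)"] zero_mem by (auto simp: m_def)
  then obtain s where sV: "\<And>k. s k \<in> V" and sJ: "\<And>k. J (s k) < m + 1 / real (Suc k)" by metis
  have mid: "sqn (\<lambda>x. f x - g x) \<le> 2 * (J f - m) + 2 * (J g - m)" if f: "f \<in> V" and g: "g \<in> V" for f g
  proof -
    define d where "d = (\<lambda>x. f x - g x)"
    have d: "d \<in> V" using f g by (simp add: d_def)
    have g_eq: "g = (\<lambda>x. f x + (- 1) * d x)" by (simp add: d_def)
    have "sqn g = sqn f - 2 * Re (ip d f) + sqn d" "\<Phi> g = \<Phi> f - \<Phi> d"
      by (subst g_eq, simp add: sqn_add_scale[OF f d, of "-1", simplified] \<Phi>_lin[OF f d, of "-1", simplified])+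
    \<comment> \<open>f - d / 2 is the midpoint of f and g. By the parallelogram law, J f + J g
      exceeds twice the value of \<open>J\<close> there by half of \<open>sqn d\<close>.\<close>
    moreover have "m \<le> J (\<lambda>x. f x + (- 1 / 2) * d x)" using f d by (intro m_le add_mem scale_mem)
    then have "m \<le> sqn f - Re (ip d f) + sqn d / 4 - 2 * Re (\<Phi> f - \<Phi> d / 2)"
      using sqn_add_scale[OF f d, of "- 1 / 2"] \<Phi>_lin[OF f d, of "- 1 / 2"]
      by (simp add: J_def power2_eq_square)
    moreover from \<open>\<Phi> g = \<Phi> f - \<Phi> d\<close> have "Re (\<Phi> g) = Re (\<Phi> f) - Re (\<Phi> d)" by simp
    ultimately show ?thesis unfolding d_def[symmetric] J_def by (simp add: algebra_simps)
  qed
  have "\<exists>N. \<forall>k\<ge>N. \<forall>l\<ge>N. Re (ip (\<lambda>x. s k x - s l x) (\<lambda>x. s k x - s l x)) < e" if e: "e > 0" for e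
  proof -
    obtain N where N: "1 / real (Suc N) < e / 4" using e nat_approx_posE[of "e / 4"] by auto
    have "Re (ip (\<lambda>x. s k x - s l x) (\<lambda>x. s k x - s l x)) < e" if "k \<ge> N" "l \<ge> N" for k l
    proof -
      have "J (s j) - m < e / 4" if "j \<ge> N" for j
      proof -
        have "J (s j) - m < 1 / real (Suc j)" using sJ[of j] by simp
        also have "\<dots> \<le> 1 / real (Suc N)" using that by (intro frac_le) auto
        finally show ?thesis using N by simp
      qed
      then have "2 * (J (s k) - m) + 2 * (J (s l) - m) < 2 * (e / 4) + 2 * (e / 4)"
        using that by (intro add_strict_mono mult_strict_left_mono) auto
      with mid[OF sV sV, of k l] have "sqn (\<lambda>x. s k x - s l x) < 2 * (e / 4) + 2 * (e / 4)"
        by (rule order.strict_trans1)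
      then show ?thesis by (simp add: sqn_def)
    qed
    then show ?thesis by blast
  qed
  from complete[OF sV this] obtain h where h: "h \<in> V"
    and lim: "(\<lambda>k. sqn (\<lambda>x. s k x - h x)) \<longlonglongrightarrow> 0"
    unfolding sqn_def by blast
  have Re_eq: "Re (\<Phi> v) = Re (ip v h)" if v: "v \<in> V" for v
  proof -
    have "(\<lambda>k. Re (ip v (\<lambda>x. s k x - h x))) \<longlonglongrightarrow> 0"
    proof (rule Lim_null_comparison)
      have "\<bar>Re (ip v (\<lambda>x. s k x - h x))\<bar> \<le> sqrt (sqn v * sqn (\<lambda>x. s k x - h x))" for k
        using Re_ip_Cauchy_Schwarz[OF v diff_mem[OF sV h], of k] by (intro real_le_rsqrt) simp
      then show "\<forall>\<^sub>F k in sequentially. norm (Re (ip v (\<lambda>x. s k x - h x)))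
          \<le> sqrt (sqn v * sqn (\<lambda>x. s k x - h x))" by simp
      have "(\<lambda>k. sqrt (sqn v * sqn (\<lambda>x. s k x - h x))) \<longlonglongrightarrow> sqrt (sqn v * 0)"
        by (intro tendsto_intros lim)
      then show "(\<lambda>k. sqrt (sqn v * sqn (\<lambda>x. s k x - h x))) \<longlonglongrightarrow> 0" by simp
    qed
    then have "(\<lambda>k. Re (ip v (\<lambda>x. s k x - h x)) + Re (ip v h)) \<longlonglongrightarrow> 0 + Re (ip v h)"
      by (intro tendsto_intros)
    then have lim_ip: "(\<lambda>k. Re (ip v (s k))) \<longlonglongrightarrow> Re (ip v h)"
      by (simp add: ip_diff_right[OF sV h v])
    have "Re (ip v h) - Re (\<Phi> v) = 0"
    proof (rule quadratic_nonneg_imp_linear_zero[OF sqn_nonneg[OF v]])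
      fix t :: real
      have ineq: "0 \<le> 1 / real (Suc k) + 2 * t * (Re (ip v (s k)) - Re (\<Phi> v)) + t\<^sup>2 * sqn v" for k
      proof -
        \<comment> \<open>The variation is made at s_k, which is within 1 / (k + 1) of the infimum,
          and k tends to infinity afterwards. Only the inner product with v has to pass to the
          limit.\<close>
        have "m \<le> J (\<lambda>x. s k x + of_real t * v x)" using sV v by (intro m_le add_mem scale_mem)
        also have "\<dots> = J (s k) + 2 * t * (Re (ip v (s k)) - Re (\<Phi> v)) + t\<^sup>2 * sqn v"
          using sqn_add_scale[OF sV v, of k "of_real t"] \<Phi>_lin[OF sV v, of k "of_real t"]
          by (simp add: J_def algebra_simps)
        finally show ?thesis using sJ[of k] by linarith
      qed
      have "(\<lambda>k. 1 / real (Suc k) + 2 * t * (Re (ip v (s k)) - Re (\<Phi> v)) + t\<^sup>2 * sqn v)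
          \<longlonglongrightarrow> 0 + 2 * t * (Re (ip v h) - Re (\<Phi> v)) + t\<^sup>2 * sqn v"
        by (intro tendsto_intros lim_ip lim_1_over_n[THEN LIMSEQ_Suc])
      then have "0 \<le> 0 + 2 * t * (Re (ip v h) - Re (\<Phi> v)) + t\<^sup>2 * sqn v"
        by (rule LIMSEQ_le_const) (use ineq in blast)
      then show "0 \<le> 2 * t * (Re (ip v h) - Re (\<Phi> v)) + t\<^sup>2 * sqn v" by simp
    qed
    then show ?thesis by simp
  qed
  \<comment> \<open>Replacing v by \<i> v recovers the imaginary parts.\<close>
  have eq: "\<Phi> v = ip v h" if v: "v \<in> V" for v
    using Re_eq[OF v] Re_eq[OF scale_mem[OF v, of \<i>]] \<Phi>_scale[OF v, of \<i>] ip_scale[OF v h, of \<i>]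
    by (simp add: complex_eq_iff)
  \<comment> \<open>Testing \<Phi> on h itself gives (sqn h)^2 \<le> M sqn h, from which one factor
    cancels.\<close>
  have "(sqn h)\<^sup>2 \<le> (cmod (\<Phi> h))\<^sup>2"
    using abs_Re_le_cmod[of "\<Phi> h"] sqn_nonneg[OF h] eq[OF h] by (intro power_mono) (auto simp: sqn_def)
  also have "\<dots> \<le> M * sqn h" by (rule \<Phi>_bound[OF h])
  finally have "sqn h * sqn h \<le> M * sqn h" by (simp add: power2_eq_square)
  then have "sqn h \<le> M" using sqn_nonneg[OF h] M by (cases "sqn h = 0") auto
  then show ?thesis using that h eq by blast
qed

end

section \<open>The space \<open>A\<^sup>2(u)\<close> and Toeplitz operators\<close>

lemma borel_measurable_cnj [measurable]:
  "f \<in> borel_measurable M \<Longrightarrow> (\<lambda>x. cnj (f x)) \<in> borel_measurable M"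
  by (rule borel_measurable_continuous_on[where f = cnj]) (intro continuous_intros)

text \<open>Stated with upper bounds a and b because the Carleson inequality yields bounds for the
  integrals against \<nu>, not their values.\<close>

lemma L2_product:
  fixes f g :: "'a \<Rightarrow> complex"
  assumes [measurable]: "f \<in> borel_measurable M" "g \<in> borel_measurable M"
    and f: "(\<integral>\<^sup>+x. ennreal ((cmod (f x))\<^sup>2) \<partial>M) \<le> ennreal a" and a: "a \<ge> 0"
    and g: "(\<integral>\<^sup>+x. ennreal ((cmod (g x))\<^sup>2) \<partial>M) \<le> ennreal b" and b: "b \<ge> 0"
  shows "integrable M (\<lambda>x. f x * g x)" and "(cmod (LINT x|M. f x * g x))\<^sup>2 \<le> a * b"
proof -
  let ?I = "\<integral>\<^sup>+x. ennreal (cmod (f x * g x)) \<partial>M"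
  have "?I\<^sup>2 = (\<integral>\<^sup>+x. ennreal (cmod (f x)) * ennreal (cmod (g x)) \<partial>M)\<^sup>2"
    by (simp add: norm_mult ennreal_mult)
  also have "\<dots> \<le> (\<integral>\<^sup>+x. (ennreal (cmod (f x)))\<^sup>2 \<partial>M) * (\<integral>\<^sup>+x. (ennreal (cmod (g x)))\<^sup>2 \<partial>M)"
    by (rule Cauchy_Schwarz_nn_integral) auto
  also have "\<dots> \<le> ennreal a * ennreal b"
    using f g by (intro mult_mono) (auto simp: ennreal_power)
  finally have I: "?I\<^sup>2 \<le> ennreal (a * b)" using a by (simp add: ennreal_mult')
  have "?I < \<infinity>"
  proof (rule ccontr)
    assume "\<not> ?I < \<infinity>"
    then have "?I = top" by (simp add: not_less top_unique)
    then show False using I by (simp add: power2_eq_square top_unique)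
  qed
  then show int: "integrable M (\<lambda>x. f x * g x)" by (intro integrableI_bounded) auto
  have "ennreal (cmod (LINT x|M. f x * g x)) \<le> ?I"
    by (rule integral_norm_bound_ennreal[OF int])
  then have "(ennreal (cmod (LINT x|M. f x * g x)))\<^sup>2 \<le> ?I\<^sup>2" by (intro power_mono) auto
  with I have "ennreal ((cmod (LINT x|M. f x * g x))\<^sup>2) \<le> ennreal (a * b)"
    by (simp add: ennreal_power)
  then show "(cmod (LINT x|M. f x * g x))\<^sup>2 \<le> a * b"
    using a b by simp
qed

context b2_weight
begin

section \<open>Norm, inner product and completeness of \<open>A2 u\<close>\<close>

lemma A2_iff: "f \<in> A2 u \<longleftrightarrow> f holomorphic_on unit_disc \<and> norm2 f < \<infinity>"
proof -
  have "integrable area (\<lambda>z. (cmod (f z))\<^sup>2 * u z) \<longleftrightarrow> norm2 f < \<infinity>" if f: "f holomorphic_on unit_disc"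
  proof -
    have [measurable]: "f \<in> borel_measurable area" by (rule holomorphic_measurable_area[OF f])
    have "(\<integral>\<^sup>+z. ennreal (norm ((cmod (f z))\<^sup>2 * u z)) \<partial>area) = norm2 f"
      unfolding norm2_def using u_pos
      by (subst nn_integral_\<mu>, measurable, intro nn_integral_cong_AE, eventually_elim)
         (simp add: abs_mult ennreal_mult' mult.commute)
    then show ?thesis unfolding integrable_iff_bounded by simp
  qed
  then show ?thesis by (auto simp: A2_def)
qed

lemma A2_holomorphic: "f \<in> A2 u \<Longrightarrow> f holomorphic_on unit_disc"
  by (simp add: A2_iff)

lemma A2_measurable: "f \<in> A2 u \<Longrightarrow> f \<in> borel_measurable \<mu>"
  using holomorphic_measurable_area[OF A2_holomorphic] by (simp cong: measurable_cong_sets add: sets_\<mu>)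

lemma A2_inner_\<mu>:
  assumes "f \<in> A2 u" "g \<in> A2 u"
  shows "A2_inner u f g = (LINT z|\<mu>. f z * cnj (g z))"
proof -
  have [measurable]: "f \<in> borel_measurable area" "g \<in> borel_measurable area"
    using assms by (simp_all add: holomorphic_measurable_area A2_holomorphic)
  have "(LINT z|\<mu>. f z * cnj (g z)) = (LINT z|area. u z *\<^sub>R (f z * cnj (g z)))"
    unfolding weighted_area_def
    by (rule integral_density) (use u_pos in \<open>auto elim: eventually_mono\<close>)
  then show ?thesis by (simp add: A2_inner_def scaleR_conv_of_real mult.commute)
qed

lemma A2_norm_nonneg: "0 \<le> A2_norm u f"
  unfolding A2_norm_def using u_pos
  by (intro real_sqrt_ge_zero integral_nonneg_AE) (auto elim: eventually_mono)

lemma A2_norm_square: "(A2_norm u f)\<^sup>2 = (LINT z|area. (cmod (f z))\<^sup>2 * u z)"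
  using A2_norm_nonneg[of f] by (simp add: A2_norm_def)

lemma A2_inner_self: "f \<in> A2 u \<Longrightarrow> A2_inner u f f = of_real ((A2_norm u f)\<^sup>2)"
  unfolding A2_norm_square A2_inner_def
  by (simp add: complex_norm_square[symmetric] del: of_real_power flip: of_real_mult)

lemma norm2_eq: "f \<in> A2 u \<Longrightarrow> norm2 f = ennreal ((A2_norm u f)\<^sup>2)"
proof -
  assume f: "f \<in> A2 u"
  have [measurable]: "f \<in> borel_measurable area" using f by (simp add: holomorphic_measurable_area A2_holomorphic)
  have "norm2 f = (\<integral>\<^sup>+z. ennreal ((cmod (f z))\<^sup>2 * u z) \<partial>area)"
    unfolding norm2_def using u_pos
    by (subst nn_integral_\<mu>, measurable, intro nn_integral_cong_AE, eventually_elim)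
       (simp add: ennreal_mult' mult.commute)
  also have "\<dots> = ennreal ((A2_norm u f)\<^sup>2)"
    unfolding A2_norm_square using f u_pos
    by (intro nn_integral_eq_integral) (auto simp: A2_def elim: eventually_mono)
  finally show ?thesis .
qed

lemma A2_inner_integrable:
  assumes "f \<in> A2 u" "g \<in> A2 u"
  shows "integrable \<mu> (\<lambda>z. f z * cnj (g z))"
proof (rule L2_product(1)[where a = "(A2_norm u f)\<^sup>2" and b = "(A2_norm u g)\<^sup>2"])
  show "f \<in> borel_measurable \<mu>" "(\<lambda>z. cnj (g z)) \<in> borel_measurable \<mu>"
    using A2_measurable[OF assms(1)] A2_measurable[OF assms(2)] by measurable
qed (use assms in \<open>simp_all add: norm2_eq[symmetric] norm2_def[symmetric]\<close>)

lemma norm2_add_le: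
  assumes "f holomorphic_on unit_disc" "g holomorphic_on unit_disc"
  shows "norm2 (\<lambda>z. f z + g z) \<le> 2 * norm2 f + 2 * norm2 g"
proof -
  have [measurable]: "f \<in> borel_measurable area" "g \<in> borel_measurable area"
    using assms by (simp_all add: holomorphic_measurable_area)
  have pt: "ennreal ((cmod (f z + g z))\<^sup>2) \<le> 2 * ennreal ((cmod (f z))\<^sup>2) + 2 * ennreal ((cmod (g z))\<^sup>2)" for z
  proof -
    have "(cmod (f z + g z))\<^sup>2 \<le> (cmod (f z) + cmod (g z))\<^sup>2"
      by (intro power_mono norm_triangle_ineq) auto
    also have "\<dots> \<le> 2 * (cmod (f z))\<^sup>2 + 2 * (cmod (g z))\<^sup>2"
      using sum_squares_bound[of "cmod (f z)" "cmod (g z)"] by (simp add: power2_sum)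
    finally have "ennreal ((cmod (f z + g z))\<^sup>2) \<le> ennreal (2 * (cmod (f z))\<^sup>2 + 2 * (cmod (g z))\<^sup>2)"
      by (rule ennreal_leI)
    also have "\<dots> = 2 * ennreal ((cmod (f z))\<^sup>2) + 2 * ennreal ((cmod (g z))\<^sup>2)"
      by (simp add: ennreal_mult')
    finally show ?thesis .
  qed
  have "norm2 (\<lambda>z. f z + g z) \<le> (\<integral>\<^sup>+z. 2 * ennreal ((cmod (f z))\<^sup>2) + 2 * ennreal ((cmod (g z))\<^sup>2) \<partial>\<mu>)"
    unfolding norm2_def by (intro nn_integral_mono pt)
  also have "\<dots> = 2 * norm2 f + 2 * norm2 g"
    unfolding norm2_def by (subst nn_integral_add) (auto simp: nn_integral_cmult)
  finally show ?thesis .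
qed

lemma A2_add: "f \<in> A2 u \<Longrightarrow> g \<in> A2 u \<Longrightarrow> (\<lambda>z. f z + g z) \<in> A2 u"
proof -
  assume f: "f \<in> A2 u" and g: "g \<in> A2 u"
  then have "norm2 (\<lambda>z. f z + g z) \<le> 2 * norm2 f + 2 * norm2 g"
    by (intro norm2_add_le A2_holomorphic)
  also have "\<dots> < \<infinity>" using f g by (simp add: A2_iff ennreal_mult_less_top)
  finally show ?thesis using f g by (auto simp: A2_iff intro!: holomorphic_intros)
qed

lemma A2_scale: "f \<in> A2 u \<Longrightarrow> (\<lambda>z. c * f z) \<in> A2 u"
proof -
  assume f: "f \<in> A2 u"
  then have [measurable]: "f \<in> borel_measurable area" by (simp add: holomorphic_measurable_area A2_holomorphic)
  have "norm2 (\<lambda>z. c * f z) = (\<integral>\<^sup>+z. ennreal ((cmod c)\<^sup>2) * ennreal ((cmod (f z))\<^sup>2) \<partial>\<mu>)"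
    unfolding norm2_def by (simp add: norm_mult power_mult_distrib ennreal_mult)
  also have "\<dots> = ennreal ((cmod c)\<^sup>2) * norm2 f"
    unfolding norm2_def by (rule nn_integral_cmult) measurable
  also have "\<dots> < \<infinity>" using f by (simp add: A2_iff ennreal_mult_less_top)
  finally show ?thesis using f by (auto simp: A2_iff intro!: holomorphic_intros)
qed

lemma A2_diff:
  assumes "f \<in> A2 u" "g \<in> A2 u"
  shows "(\<lambda>z. f z - g z) \<in> A2 u"
  using A2_add[OF assms(1) A2_scale[OF assms(2), of "-1"]] by simp

text \<open>One M serves the whole closed disc of radius |a|, so that norm-Cauchy sequences are
  uniformly Cauchy there.\<close>

lemma A2_point_evaluation:
  assumes a: "a \<in> unit_disc"
  obtains M where "M \<ge> 0" "\<And>f b. f \<in> A2 u \<Longrightarrow> cmod b \<le> cmod a \<Longrightarrow> (cmod (f b))\<^sup>2 \<le> M * (A2_norm u f)\<^sup>2"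
proof -
  obtain C :: real where C: "C > 0"
    "\<And>f a. f holomorphic_on unit_disc \<Longrightarrow> a \<in> unit_disc \<Longrightarrow>
       ennreal ((cmod (f a))\<^sup>2) * ennreal ((1 - cmod a) ^ 4) \<le> ennreal C * norm2 f"
    using pointwise_bound by blast
  define d where "d = (1 - cmod a) ^ 4"
  have d: "d > 0" using a by (simp add: d_def)
  show ?thesis
  proof (rule that[of "C / d"])
    show "C / d \<ge> 0" using C d by simp
    fix f b assume f: "f \<in> A2 u" and b: "cmod b \<le> cmod a"
    then have "ennreal ((cmod (f b))\<^sup>2) * ennreal ((1 - cmod b) ^ 4) \<le> ennreal C * norm2 f"
      using a by (intro C A2_holomorphic) auto
    then have "(cmod (f b))\<^sup>2 * (1 - cmod b) ^ 4 \<le> C * (A2_norm u f)\<^sup>2"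
      using C(1) by (simp add: norm2_eq[OF f] flip: ennreal_mult)
    moreover have "(cmod (f b))\<^sup>2 * d \<le> (cmod (f b))\<^sup>2 * (1 - cmod b) ^ 4"
      unfolding d_def using a b by (intro mult_left_mono power_mono) auto
    ultimately show "(cmod (f b))\<^sup>2 \<le> C / d * (A2_norm u f)\<^sup>2"
      using d by (simp add: field_simps)
  qed
qed

text \<open>Bounded point evaluations make the sequence locally uniformly Cauchy, so its pointwise
  limit is holomorphic; Fatou's lemma then upgrades this to convergence in norm.\<close>

lemma A2_complete:
  assumes s: "\<And>k::nat. s k \<in> A2 u"
    and Cauchy: "\<And>e. e > 0 \<Longrightarrow> \<exists>N. \<forall>k\<ge>N. \<forall>l\<ge>N. (A2_norm u (\<lambda>z. s k z - s l z))\<^sup>2 < e"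
  obtains g where "g \<in> A2 u" "(\<lambda>k. (A2_norm u (\<lambda>z. s k z - g z))\<^sup>2) \<longlonglongrightarrow> 0"
proof -
  define g where "g z = lim (\<lambda>k. s k z)" for z
  have unif: "uniform_limit (cball 0 (cmod a)) s g sequentially" if a: "a \<in> unit_disc" for a
  proof -
    obtain M where M: "M \<ge> 0" "\<And>f b. f \<in> A2 u \<Longrightarrow> cmod b \<le> cmod a \<Longrightarrow> (cmod (f b))\<^sup>2 \<le> M * (A2_norm u f)\<^sup>2"
      using A2_point_evaluation[OF a] by blast
    have "uniformly_Cauchy_on (cball 0 (cmod a)) s"
      unfolding uniformly_Cauchy_on_def
    proof (intro allI impI)
      fix e :: real assume e: "e > 0"
      \<comment> \<open>M may be 0; M + 1 keeps the quotient positive and M e^2 / (M + 1) strictly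
        below e^2.\<close>
      have "e\<^sup>2 / (M + 1) > 0" using e M by simp
      from Cauchy[OF this] obtain N where N: "\<And>k l. k \<ge> N \<Longrightarrow> l \<ge> N \<Longrightarrow> (A2_norm u (\<lambda>z. s k z - s l z))\<^sup>2 < e\<^sup>2 / (M + 1)"
        by blast
      have "dist (s m x) (s n x) < e" if x: "x \<in> cball 0 (cmod a)" and mn: "m \<ge> N" "n \<ge> N" for x m n
      proof -
        have "(cmod (s m x - s n x))\<^sup>2 \<le> M * (A2_norm u (\<lambda>z. s m z - s n z))\<^sup>2"
          using M(2)[OF A2_diff[OF s s]] x by simp
        also have "\<dots> \<le> M * (e\<^sup>2 / (M + 1))" using N[OF mn] M by (intro mult_left_mono) auto
        also have "\<dots> < e\<^sup>2" using M e by (simp add: field_simps)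
        finally show ?thesis using e by (auto simp: dist_norm intro: power2_less_imp_less)
      qed
      then show "\<exists>N. \<forall>x\<in>cball 0 (cmod a). \<forall>m\<ge>N. \<forall>n\<ge>N. dist (s m x) (s n x) < e" by blast
    qed
    then show ?thesis
      using Cauchy_uniformly_convergent unfolding uniformly_convergent_uniform_limit_iff g_def[abs_def]
      by blast
  qed
  have g: "g holomorphic_on unit_disc"
  proof (rule holomorphic_uniform_sequence[OF open_ball, of s])
    show "s n holomorphic_on unit_disc" for n by (rule A2_holomorphic[OF s])
    fix x :: complex assume x: "x \<in> unit_disc"
    define d where "d = (1 - cmod x) / 2"
    have d: "d > 0" "cmod x + d < 1" using x by (auto simp: d_def field_simps)
    have nb: "cmod (of_real (cmod x + d) :: complex) = cmod x + d"
      using d norm_ge_zero[of x] by (simp only: norm_of_real)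
    then have "uniform_limit (cball 0 (cmod x + d)) s g sequentially"
      using unif[of "of_real (cmod x + d)"] d by (simp del: of_real_add)
    moreover have sub: "cball x d \<subseteq> cball 0 (cmod x + d)" by (simp add: cball_subset_cball_iff)
    moreover have "cball 0 (cmod x + d) \<subseteq> unit_disc" using d by auto
    ultimately show "\<exists>d>0. cball x d \<subseteq> unit_disc \<and> uniform_limit (cball x d) s g sequentially"
      using d(1) uniform_limit_on_subset by (intro exI[of _ d]) blast
  qed
  have lim: "(\<lambda>k. s k z) \<longlonglongrightarrow> g z" if "z \<in> unit_disc" for z
    using tendsto_uniform_limitI[OF unif[OF that]] by simp
  \<comment> \<open>Fatou in l carries the Cauchy estimate for s_k - s_l over to s_k - g before g is
    known to have finite norm.\<close>
  have tail: "norm2 (\<lambda>z. s k z - g z) \<le> ennreal e"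
    if N: "\<And>l. l \<ge> N \<Longrightarrow> (A2_norm u (\<lambda>z. s k z - s l z))\<^sup>2 < e" for k N e
  proof -
    have [measurable]: "(\<lambda>z. s k z - s l z) \<in> borel_measurable \<mu>" for l
      by (rule A2_measurable[OF A2_diff[OF s s]])
    have "norm2 (\<lambda>z. s k z - g z) = (\<integral>\<^sup>+z. liminf (\<lambda>l. ennreal ((cmod (s k z - s l z))\<^sup>2)) \<partial>\<mu>)"
      unfolding norm2_def
    proof (rule nn_integral_cong)
      fix z assume "z \<in> space \<mu>"
      then have "(\<lambda>l. ennreal ((cmod (s k z - s l z))\<^sup>2)) \<longlonglongrightarrow> ennreal ((cmod (s k z - g z))\<^sup>2)"
        by (intro tendsto_intros lim) simp
      then show "ennreal ((cmod (s k z - g z))\<^sup>2) = liminf (\<lambda>l. ennreal ((cmod (s k z - s l z))\<^sup>2))"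
        by (rule lim_imp_Liminf[OF sequentially_bot, symmetric])
    qed
    also have "\<dots> \<le> liminf (\<lambda>l. norm2 (\<lambda>z. s k z - s l z))"
      unfolding norm2_def by (rule nn_integral_liminf) measurable
    also have "\<dots> \<le> ennreal e"
    proof (rule Liminf_le[OF sequentially_bot])
      show "\<forall>\<^sub>F l in sequentially. norm2 (\<lambda>z. s k z - s l z) \<le> ennreal e"
        using eventually_ge_at_top[of N]
        by eventually_elim (simp add: norm2_eq[OF A2_diff[OF s s]] N less_imp_le ennreal_leI)
    qed
    finally show ?thesis .
  qed
  have diff_A2: "(\<lambda>z. s k z - g z) \<in> A2 u"
    if "\<And>l. l \<ge> N \<Longrightarrow> (A2_norm u (\<lambda>z. s k z - s l z))\<^sup>2 < e" for k N e
    using tail[OF that] by (auto simp: A2_iff less_top[symmetric] top_unique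
        intro!: holomorphic_intros g A2_holomorphic[OF s])
  obtain N1 where N1: "\<And>k l. k \<ge> N1 \<Longrightarrow> l \<ge> N1 \<Longrightarrow> (A2_norm u (\<lambda>z. s k z - s l z))\<^sup>2 < 1"
    using Cauchy[of 1] by auto
  \<comment> \<open>g is s_N1 - (s_N1 - g), and the tail estimate puts the bracket in the
    space.\<close>
  have "g \<in> A2 u"
    using A2_diff[OF s[of N1] diff_A2[of N1 N1 1]] N1 by simp
  moreover have "(\<lambda>k. (A2_norm u (\<lambda>z. s k z - g z))\<^sup>2) \<longlonglongrightarrow> 0"
  proof (rule LIMSEQ_I)
    fix e :: real assume e: "e > 0"
    then obtain N where N: "\<And>k l. k \<ge> N \<Longrightarrow> l \<ge> N \<Longrightarrow> (A2_norm u (\<lambda>z. s k z - s l z))\<^sup>2 < e / 2"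
      using Cauchy[of "e / 2"] by auto
    have "(A2_norm u (\<lambda>z. s k z - g z))\<^sup>2 < e" if k: "k \<ge> N" for k
      using tail[of N k "e / 2"] diff_A2[of N k "e / 2"] N[OF k] e by (simp add: norm2_eq)
    then show "\<exists>N. \<forall>k\<ge>N. norm ((A2_norm u (\<lambda>z. s k z - g z))\<^sup>2 - 0) < e" by auto
  qed
  ultimately show ?thesis by (rule that)
qed

sublocale A2: complete_function_space "A2 u" "A2_inner u"
proof
  show "(\<lambda>_. 0) \<in> A2 u" by (simp add: A2_def)
  fix f g h c
  show add: "f \<in> A2 u \<Longrightarrow> g \<in> A2 u \<Longrightarrow> (\<lambda>x. f x + g x) \<in> A2 u" by (rule A2_add)
  show scale: "f \<in> A2 u \<Longrightarrow> (\<lambda>x. c * f x) \<in> A2 u" by (rule A2_scale)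
  show "A2_inner u (\<lambda>x. f x + g x) h = A2_inner u f h + A2_inner u g h"
    if "f \<in> A2 u" "g \<in> A2 u" "h \<in> A2 u"
    using that by (simp add: A2_inner_\<mu> A2_add distrib_right A2_inner_integrable)
  show "A2_inner u (\<lambda>x. c * f x) h = c * A2_inner u f h"
    if "f \<in> A2 u" "h \<in> A2 u"
    using that by (simp add: A2_inner_\<mu> A2_scale mult.assoc)
  show "A2_inner u g f = cnj (A2_inner u f g)"
  proof -
    have "cnj (A2_inner u f g) = (LINT z|area. cnj (f z * cnj (g z) * of_real (u z)))"
      unfolding A2_inner_def by (rule Bochner_Integration.integral_cnj[symmetric])
    also have "\<dots> = A2_inner u g f"
      unfolding A2_inner_def by (rule arg_cong[where f = "integral\<^sup>L area"]) (simp add: fun_eq_iff)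
    finally show ?thesis ..
  qed
  show "0 \<le> Re (A2_inner u f f)" if "f \<in> A2 u"
    using that by (simp add: A2_inner_self)
next
  fix s :: "nat \<Rightarrow> complex \<Rightarrow> complex"
  assume s: "\<And>k. s k \<in> A2 u"
    and C: "\<And>e. e > 0 \<Longrightarrow> \<exists>N. \<forall>k\<ge>N. \<forall>l\<ge>N. Re (A2_inner u (\<lambda>x. s k x - s l x) (\<lambda>x. s k x - s l x)) < e"
  have eq: "Re (A2_inner u (\<lambda>x. s k x - f x) (\<lambda>x. s k x - f x)) = (A2_norm u (\<lambda>x. s k x - f x))\<^sup>2"
    if "f \<in> A2 u" for k f
    using that s by (simp add: A2_inner_self A2_diff)
  have C': "\<exists>N. \<forall>k\<ge>N. \<forall>l\<ge>N. (A2_norm u (\<lambda>x. s k x - s l x))\<^sup>2 < e" if "e > 0" for e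
    using C[OF that] unfolding eq[OF s] .
  obtain h where h: "h \<in> A2 u" "(\<lambda>k. (A2_norm u (\<lambda>z. s k z - h z))\<^sup>2) \<longlonglongrightarrow> 0"
    by (rule A2_complete[of s, OF s C'], assumption, rule that)
  show "\<exists>h\<in>A2 u. (\<lambda>k. Re (A2_inner u (\<lambda>x. s k x - h x) (\<lambda>x. s k x - h x))) \<longlonglongrightarrow> 0"
    using h(2) unfolding eq[OF h(1), symmetric] by (intro bexI[OF _ h(1)])
qed

section \<open>Reproducing kernel and Toeplitz operator\<close>

lemma A2_sqn: "f \<in> A2 u \<Longrightarrow> A2.sqn f = (A2_norm u f)\<^sup>2"
  by (simp add: A2.sqn_def A2_inner_self)

lemma bergman_kernel_reproduces:
  assumes a: "a \<in> unit_disc"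
  shows "reproduces_at u a (\<lambda>z. bergman_kernel u z a)"
proof -
  obtain M where M: "M \<ge> 0" "\<And>f b. f \<in> A2 u \<Longrightarrow> cmod b \<le> cmod a \<Longrightarrow> (cmod (f b))\<^sup>2 \<le> M * (A2_norm u f)\<^sup>2"
    using A2_point_evaluation[OF a] by blast
  have bound: "(cmod (f a))\<^sup>2 \<le> M * A2.sqn f" if "f \<in> A2 u" for f
    using M(2)[OF that, of a] by (simp add: A2_sqn[OF that])
  obtain k where k: "k \<in> A2 u" "\<And>f. f \<in> A2 u \<Longrightarrow> f a = A2_inner u f k" "A2.sqn k \<le> M"
    by (rule A2.Riesz_representation[of "\<lambda>f. f a" M, OF refl refl bound M(1)], assumption, rule that)
  have "reproduces_at u a k"
    unfolding reproduces_at_def by (intro conjI ballI k)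
  then show ?thesis unfolding bergman_kernel_def by (rule someI[of "reproduces_at u a"])
qed

text \<open>Reproducing K_w at z gives K_w(z) = <K_w, K_z>; exchanging the two points conjugates the
  inner product.\<close>

lemma bergman_kernel_cnj:
  assumes z: "z \<in> unit_disc" and w: "w \<in> unit_disc"
  shows "bergman_kernel u z w = cnj (bergman_kernel u w z)"
  using bergman_kernel_reproduces[OF z] bergman_kernel_reproduces[OF w] A2.ip_cnj
  unfolding reproduces_at_def by metis

text \<open>The Carleson inequality for g and for f gives |\<Phi> g| \<le> C |g| |f| in the norms of
  \<open>A2 u\<close>, so the representative h has norm at most C |f|.\<close>

lemma toeplitz_eq_Riesz:
  assumes \<nu>: "prob_space \<nu>" and sets: "sets \<nu> = sets (restrict_space borel unit_disc)"
    and C: "C > 0" "\<And>f. f holomorphic_on unit_disc \<Longrightarrow> (\<integral>\<^sup>+z. ennreal ((cmod (f z))\<^sup>2) \<partial>\<nu>) \<le> ennreal C * norm2 f"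
    and f: "f \<in> A2 u"
  obtains h where "h \<in> A2 u" "A2_norm u h \<le> C * A2_norm u f"
    "\<And>z. z \<in> unit_disc \<Longrightarrow> integrable \<nu> (\<lambda>w. bergman_kernel u z w * f w)"
    "\<And>z. z \<in> unit_disc \<Longrightarrow> toeplitz u \<nu> f z = h z"
proof -
  have space: "space \<nu> = unit_disc" using sets_eq_imp_space_eq[OF sets] by (simp add: space_restrict_space)
  have meas: "g \<in> borel_measurable \<nu>" if "g \<in> A2 u" for g
    using borel_measurable_continuous_on_restrict[OF holomorphic_on_imp_continuous_on[OF A2_holomorphic[OF that]]] sets
    by (simp cong: measurable_cong_sets)
  define \<Phi> where "\<Phi> g = (LINT w|\<nu>. g w * cnj (f w))" for g
  have bnd: "(\<integral>\<^sup>+z. ennreal ((cmod (g z))\<^sup>2) \<partial>\<nu>) \<le> ennreal (C * (A2_norm u g)\<^sup>2)" if g: "g \<in> A2 u" for g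
    using C(2)[OF A2_holomorphic[OF g]] C(1) by (simp add: norm2_eq[OF g] ennreal_mult)
  have bnd_cnj: "(\<integral>\<^sup>+z. ennreal ((cmod (cnj (f z)))\<^sup>2) \<partial>\<nu>) \<le> ennreal (C * (A2_norm u f)\<^sup>2)"
    using bnd[OF f] by simp
  have cnj_meas: "(\<lambda>z. cnj (f z)) \<in> borel_measurable \<nu>" using meas[OF f] by measurable
  have int: "integrable \<nu> (\<lambda>w. g w * cnj (f w))"
    and le: "(cmod (\<Phi> g))\<^sup>2 \<le> (C * (A2_norm u g)\<^sup>2) * (C * (A2_norm u f)\<^sup>2)" if g: "g \<in> A2 u" for g
    unfolding \<Phi>_def using L2_product[OF meas[OF g] cnj_meas bnd[OF g] _ bnd_cnj] C by simp_all
  have \<Phi>_add: "\<Phi> (\<lambda>x. g x + k x) = \<Phi> g + \<Phi> k" if "g \<in> A2 u" "k \<in> A2 u" for g k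
    unfolding \<Phi>_def using int[OF that(1)] int[OF that(2)] by (simp add: distrib_right)
  have \<Phi>_scale: "\<Phi> (\<lambda>x. c * g x) = c * \<Phi> g" if "g \<in> A2 u" for c g
    unfolding \<Phi>_def by (simp add: mult.assoc)
  have \<Phi>_bound: "(cmod (\<Phi> g))\<^sup>2 \<le> C\<^sup>2 * (A2_norm u f)\<^sup>2 * A2.sqn g" if "g \<in> A2 u" for g
    using le[OF that] by (simp add: A2_sqn[OF that] power2_eq_square mult_ac)
  have nonneg: "0 \<le> C\<^sup>2 * (A2_norm u f)\<^sup>2" by simp
  obtain h where h: "h \<in> A2 u" "\<And>g. g \<in> A2 u \<Longrightarrow> \<Phi> g = A2_inner u g h" "A2.sqn h \<le> C\<^sup>2 * (A2_norm u f)\<^sup>2"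
    by (rule A2.Riesz_representation[of \<Phi>, OF \<Phi>_add \<Phi>_scale \<Phi>_bound nonneg], assumption+, rule that)
  show ?thesis
  proof (rule that[OF h(1)])
    have "(A2_norm u h)\<^sup>2 \<le> (C * A2_norm u f)\<^sup>2"
      using h by (simp add: A2_sqn power_mult_distrib)
    then show "A2_norm u h \<le> C * A2_norm u f"
      using C A2_norm_nonneg[of f] by (auto intro: power2_le_imp_le)
    fix z assume z: "z \<in> unit_disc"
    let ?k = "\<lambda>w. bergman_kernel u w z"
    have k: "?k \<in> A2 u" "\<And>g. g \<in> A2 u \<Longrightarrow> g z = A2_inner u g ?k"
      using bergman_kernel_reproduces[OF z] by (auto simp: reproduces_at_def)
    have eq: "bergman_kernel u z w * f w = cnj (?k w * cnj (f w))" if "w \<in> space \<nu>" for w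
      using bergman_kernel_cnj[OF z] that by (simp add: space)
    have "integrable \<nu> (\<lambda>w. cnj (?k w * cnj (f w)))"
      using int[OF k(1)] integrable_cnj by blast
    then show "integrable \<nu> (\<lambda>w. bergman_kernel u z w * f w)"
      using eq by (subst Bochner_Integration.integrable_cong[OF refl eq]) auto
    \<comment> \<open>With K_z the kernel at z, the chain is T f(z) = cnj(\<Phi> K_z) = cnj <K_z, h>
      = <h, K_z> = h(z).\<close>
    have "toeplitz u \<nu> f z = (LINT w|\<nu>. cnj (?k w * cnj (f w)))"
      unfolding toeplitz_def by (rule Bochner_Integration.integral_cong[OF refl eq])
    also have "\<dots> = cnj (\<Phi> ?k)" unfolding \<Phi>_def by (rule Bochner_Integration.integral_cnj)
    also have "\<dots> = h z" using h(1,2) k A2.ip_cnj[OF k(1) h(1)] by simp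
    finally show "toeplitz u \<nu> f z = h z" .
  qed
qed

text \<open>The Toeplitz integral is identified with h on the disc only; elsewhere the chosen
  kernels have arbitrary values.\<close>

lemma A2_cong:
  assumes eq: "\<And>z. z \<in> unit_disc \<Longrightarrow> f z = g z"
  shows "f \<in> A2 u \<longleftrightarrow> g \<in> A2 u" and "A2_norm u f = A2_norm u g"
proof -
  have "f holomorphic_on unit_disc \<longleftrightarrow> g holomorphic_on unit_disc"
    by (rule holomorphic_cong) (auto simp: eq)
  moreover have "integrable area (\<lambda>z. (cmod (f z))\<^sup>2 * u z) \<longleftrightarrow> integrable area (\<lambda>z. (cmod (g z))\<^sup>2 * u z)"
    by (rule Bochner_Integration.integrable_cong) (auto simp: eq)
  ultimately show "f \<in> A2 u \<longleftrightarrow> g \<in> A2 u" by (simp add: A2_def)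
  have "(LINT z|area. (cmod (f z))\<^sup>2 * u z) = (LINT z|area. (cmod (g z))\<^sup>2 * u z)"
    by (rule Bochner_Integration.integral_cong) (auto simp: eq)
  then show "A2_norm u f = A2_norm u g" by (simp add: A2_norm_def)
qed

end

theorem proposition3p4:
  fixes u :: "complex \<Rightarrow> real" and \<nu> :: "complex measure"
  assumes "disc_weight u"
    and "B2_condition u"
    and "prob_space (weighted_area u)"
    and "prob_space \<nu>"
    and "sets \<nu> = sets (restrict_space borel unit_disc)"
    and "carleson_measure \<nu> (weighted_area u)"
  shows "toeplitz_bounded u \<nu>"
proof -
  interpret b2_weight u by (rule b2_weight.intro[OF assms(1-3)])
  obtain C :: real where C: "C > 0"
    "\<And>f. f holomorphic_on unit_disc \<Longrightarrow> (\<integral>\<^sup>+z. ennreal ((cmod (f z))\<^sup>2) \<partial>\<nu>) \<le> ennreal C * norm2 f"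
    using carleson_holomorphic[OF assms(4-6)] by blast
  show ?thesis
    unfolding toeplitz_bounded_def
  proof (intro exI[of _ C] ballI)
    fix f assume f: "f \<in> A2 u"
    obtain h where h: "h \<in> A2 u" "A2_norm u h \<le> C * A2_norm u f"
      "\<And>z. z \<in> unit_disc \<Longrightarrow> integrable \<nu> (\<lambda>w. bergman_kernel u z w * f w)"
      "\<And>z. z \<in> unit_disc \<Longrightarrow> toeplitz u \<nu> f z = h z"
      using toeplitz_eq_Riesz[OF assms(4,5) C f] by blast
    show "(\<forall>z\<in>unit_disc. integrable \<nu> (\<lambda>w. bergman_kernel u z w * f w)) \<and>
      toeplitz u \<nu> f \<in> A2 u \<and> A2_norm u (toeplitz u \<nu> f) \<le> C * A2_norm u f"
      using A2_cong[of "toeplitz u \<nu> f" h, OF h(4)] h(1-3) by auto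
  qed
qed

end
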